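(* For every $n\ge 1$ we have the Schur expansions $$\prod_{1\le i<j\le n}(1+x_i+x_j)=\sum_{\mu\subseteq\delta_{n-1}} r^{(n)}_\mu\, s_\mu(x_1,\dots,x_n),$$ $$\prod_{1\le i\le j\le n}(1+x_i+x_j)=\sum_{\lambda\subseteq\delta_n}\ \sum_{\substack{\mu\subseteq \lambda\cap\delta_{n-1}\\ \lambda/\mu \text{ a vertical strip}}} 2^{|\lambda/\mu|}\, r^{(n)}_\mu\, s_\lambda(x_1,\dots,x_n).$$
   Context: Partitions are identified with their Ferrers diagrams (row $i$ has $\lambda_i$ left-justified boxes), and $\mu\subseteq\lambda$ means containment of diagrams. For $m\ge 0$, $\delta_m=(m,m-1,\dots,1)$ is the staircase partition (with $\delta_0=\varnothing$). For a partition $\mu\subseteq\delta_{n-1}$, a reverse flagged filling of shape $\mu$ is a filling of the boxes of $\mu$ with positive integers such that entries strictly decrease from left to right along each row, weakly decrease from top to bottom down each column, and every entry in row $i$ lies in $\{1,2,\dots,n-i\}$. $r^{(n)}_\mu$ denotes the number of reverse flagged fillings of shape $\mu$ (the empty shape has exactly one filling). For $\mu\subseteq\lambda$, $\lambda/\mu$ is the set of boxes of $\lambda$ not in $\mu$, $|\lambda/\mu|$ its number of boxes, and $\lambda/\mu$ is a vertical strip if no row contains more than one of its boxes. $s_\mu(x_1,\dots,x_n)$ denotes the Schur polynomial in $n$ variables (zero if $\mu$ has more than $n$ parts). *)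

theory Defs
  imports "HOL-Library.Poly_Mapping" "HOL-Library.FuncSet"
begin

section \<open>Partitions and Ferrers diagrams\<close>

text \<open>Partitions are lists of positive parts, so that a partition is determined by its diagram.
  Boxes are pairs (row, column), both counted from 1.\<close>

definition is_partition :: "nat list \<Rightarrow> bool" where
  "is_partition \<mu> \<longleftrightarrow> sorted_wrt (\<ge>) \<mu> \<and> (\<forall>k\<in>set \<mu>. 0 < k)"

definition ferrers :: "nat list \<Rightarrow> (nat \<times> nat) set" where
  "ferrers \<mu> = {(i, j). 1 \<le> i \<and> i \<le> length \<mu> \<and> 1 \<le> j \<and> j \<le> \<mu> ! (i - 1)}"

definition staircase :: "nat \<Rightarrow> nat list" where
  "staircase m = rev [1..<Suc m]"

definition vertical_strip :: "(nat \<times> nat) set \<Rightarrow> bool" where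
  "vertical_strip S \<longleftrightarrow> (\<forall>i j j'. (i, j) \<in> S \<longrightarrow> (i, j') \<in> S \<longrightarrow> j = j')"

section \<open>Reverse flagged fillings\<close>

text \<open>A filling is a function on the boxes of the diagram, made extensional so that the
  fillings of a given shape can be counted.\<close>

definition reverse_flagged_fillings :: "nat \<Rightarrow> nat list \<Rightarrow> (nat \<times> nat \<Rightarrow> nat) set" where
  "reverse_flagged_fillings n \<mu> =
    {T \<in> (\<Pi>\<^sub>E b\<in>ferrers \<mu>. {1..n - fst b}).
       (\<forall>i j j'. (i, j) \<in> ferrers \<mu> \<longrightarrow> (i, j') \<in> ferrers \<mu> \<longrightarrow> j < j' \<longrightarrow> T (i, j) > T (i, j')) \<and>
       (\<forall>i i' j. (i, j) \<in> ferrers \<mu> \<longrightarrow> (i', j) \<in> ferrers \<mu> \<longrightarrow> i < i' \<longrightarrow> T (i, j) \<ge> T (i', j))}"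

definition rev_flag_count :: "nat \<Rightarrow> nat list \<Rightarrow> nat" where
  "rev_flag_count n \<mu> = card (reverse_flagged_fillings n \<mu>)"

section \<open>Schur polynomials\<close>

text \<open>Polynomials with integer coefficients: finitely supported maps from monomials
  (exponent vectors) to coefficients, with convolution as product.\<close>

type_synonym mpoly_int = "(nat \<Rightarrow>\<^sub>0 nat) \<Rightarrow>\<^sub>0 int"

definition X :: "nat \<Rightarrow> mpoly_int" where
  "X i = Poly_Mapping.single (Poly_Mapping.single i 1) 1"

definition semistandard_tableaux :: "nat \<Rightarrow> nat list \<Rightarrow> (nat \<times> nat \<Rightarrow> nat) set" where
  "semistandard_tableaux n \<mu> =
    {T \<in> ferrers \<mu> \<rightarrow>\<^sub>E {1..n}.
       (\<forall>i j j'. (i, j) \<in> ferrers \<mu> \<longrightarrow> (i, j') \<in> ferrers \<mu> \<longrightarrow> j < j' \<longrightarrow> T (i, j) \<le> T (i, j')) \<and>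
       (\<forall>i i' j. (i, j) \<in> ferrers \<mu> \<longrightarrow> (i', j) \<in> ferrers \<mu> \<longrightarrow> i < i' \<longrightarrow> T (i, j) < T (i', j))}"

text \<open>The Schur polynomial in the variables \<open>X 1, \<dots>, X n\<close>; there are no tableaux, and the
  sum is zero, if the shape has more than \<open>n\<close> rows.\<close>

definition schur :: "nat \<Rightarrow> nat list \<Rightarrow> mpoly_int" where
  "schur n \<mu> = (\<Sum>T\<in>semistandard_tableaux n \<mu>. \<Prod>b\<in>ferrers \<mu>. X (T b))"

section \<open>Finiteness of the index sets\<close>

lemma finite_ferrers [simp]: "finite (ferrers \<mu>)"
proof (rule finite_subset)
  show "ferrers \<mu> \<subseteq> (SIGMA i:{1..length \<mu>}. {1..\<mu> ! (i - 1)})"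
    by (auto simp: ferrers_def)
qed auto

lemma finite_reverse_flagged_fillings [simp]: "finite (reverse_flagged_fillings n \<mu>)"
  unfolding reverse_flagged_fillings_def
  by (rule finite_subset[OF _ finite_PiE[of "ferrers \<mu>" "\<lambda>b. {1..n - fst b}"]]) auto

lemma finite_semistandard_tableaux [simp]: "finite (semistandard_tableaux n \<mu>)"
  unfolding semistandard_tableaux_def
  by (rule finite_subset[OF _ finite_PiE[of "ferrers \<mu>" "\<lambda>_. {1..n}"]]) auto

lemma finite_partitions_within:
  assumes "finite S"
  shows "finite {\<mu>. is_partition \<mu> \<and> ferrers \<mu> \<subseteq> S}"
proof (rule finite_subset)
  show "{\<mu>. is_partition \<mu> \<and> ferrers \<mu> \<subseteq> S} \<subseteq> {\<mu>. set \<mu> \<subseteq> snd ` S \<and> length \<mu> \<le> card (fst ` S)}"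
  proof (rule subsetI, clarsimp, intro conjI)
    fix \<mu> assume p: "is_partition \<mu>" and s: "ferrers \<mu> \<subseteq> S"
    have box: "(Suc i, \<mu> ! i) \<in> S" if "i < length \<mu>" for i
    proof -
      have "0 < \<mu> ! i" using p that by (auto simp: is_partition_def)
      then have "(Suc i, \<mu> ! i) \<in> ferrers \<mu>" using that by (simp add: ferrers_def)
      then show ?thesis using s by blast
    qed
    show "set \<mu> \<subseteq> snd ` S" using box by (force simp: in_set_conv_nth)
    have "Suc ` {..<length \<mu>} \<subseteq> fst ` S" using box by force
    then have "card (Suc ` {..<length \<mu>}) \<le> card (fst ` S)"
      using assms by (intro card_mono) auto
    then show "length \<mu> \<le> card (fst ` S)" by (simp add: card_image)
  qed
  show "finite {\<mu>. set \<mu> \<subseteq> snd ` S \<and> length \<mu> \<le> card (fst ` S)}"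
    using assms by (intro finite_lists_length_le) auto
qed

end

theory Submission
  imports Defs "Jordan_Normal_Form.Determinant"
begin

text \<open>
  Put \<open>z\<^sub>i = x\<^sub>i (1 + x\<^sub>i)\<close>. Since \<open>(x\<^sub>i - x\<^sub>j) (1 + x\<^sub>i + x\<^sub>j) = z\<^sub>i - z\<^sub>j\<close>, the first product times the
  Vandermonde determinant in the \<open>x\<^sub>i\<close> is the Vandermonde determinant in the \<open>z\<^sub>i\<close>. Its column
  \<open>z\<^sub>i\<^sup>k\<close> is expanded by applying \<open>k\<close> times the factor \<open>x\<^sub>i (1 + x\<^sub>i)\<close>: the factor \<open>x\<^sub>i\<close> makes room
  for one more row, and choosing \<open>1\<close> or \<open>x\<^sub>i\<close> from \<open>1 + x\<^sub>i\<close> in every column adds a vertical strip.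
  On the other side, the entries \<open>1\<close> of a reverse flagged filling form a vertical strip, and
  removing them and lowering all other entries by one gives a filling for \<open>n - 1\<close>. So the
  numbers of fillings obey the recurrence of the coefficients of the alternants, and the
  bialternant formula for Schur polynomials gives the first expansion. Multiplying alternants by
  \<open>\<Prod>\<^sub>i (1 + 2 x\<^sub>i)\<close> adds one further vertical strip, in which every box has weight \<open>2\<close>.

  The bialternant formula holds because subtracting suitable multiples of adjacent columns makes
  alternants satisfy the branching rule of semistandard tableaux.
\<close>

section \<open>Alternants\<close>

text \<open>Rows and columns are counted from 0, so \<open>x i\<close> stands for the variable \<open>X (Suc i)\<close>; a
  partition is a weakly decreasing function from row numbers (from 0) to row lengths, with zeros
  after the last part.\<close>

definition fdet :: "nat \<Rightarrow> (nat \<Rightarrow> nat \<Rightarrow> 'a::comm_ring_1) \<Rightarrow> 'a" where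
  "fdet n f = det (mat n n (\<lambda>(i, j). f i j))"

lemma fdet_expand_rows:
  "fdet n f = (\<Sum>p | p permutes {0..<n}. signof p * (\<Prod>i<n. f i (p i)))"
proof -
  have "(\<Prod>i=0..<n. mat n n (\<lambda>(i, j). f i j) $$ (i, p i)) = (\<Prod>i<n. f i (p i))"
    if "p permutes {0..<n}" for p
  proof (rule prod.cong)
    fix k assume "k \<in> {..<n}"
    then have "p k < n" using permutes_in_image[OF that, of k] by simp
    then show "mat n n (\<lambda>(i, j). f i j) $$ (k, p k) = f k (p k)" using \<open>k \<in> {..<n}\<close> by simp
  qed auto
  then show ?thesis
    unfolding fdet_def by (subst det_def'[of _ n]) auto
qed

lemma fdet_expand_cols:
  "fdet n f = (\<Sum>p | p permutes {0..<n}. signof p * (\<Prod>j<n. f (p j) j))"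
proof -
  have "(\<Prod>j<n. mat n n (\<lambda>(i, j). f i j) $$ (p j, j)) = (\<Prod>j<n. f (p j) j)"
    if "p permutes {0..<n}" for p
  proof (rule prod.cong)
    fix k assume "k \<in> {..<n}"
    then have "p k < n" using permutes_in_image[OF that, of k] by simp
    then show "mat n n (\<lambda>(i, j). f i j) $$ (p k, k) = f (p k) k" using \<open>k \<in> {..<n}\<close> by simp
  qed auto
  then show ?thesis
    unfolding fdet_def by (subst det_col[of _ n]) auto
qed

lemma fdet_cong:
  assumes "\<And>i j. i < n \<Longrightarrow> j < n \<Longrightarrow> f i j = g i j"
  shows "fdet n f = fdet n g"
proof -
  have "mat n n (\<lambda>(i, j). f i j) = mat n n (\<lambda>(i, j). g i j)"
    using assms by (intro eq_matI) auto
  then show ?thesis by (simp add: fdet_def)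
qed

lemma fdet_scale_rows: "fdet n (\<lambda>i j. c i * f i j) = (\<Prod>i<n. c i) * fdet n f"
  by (simp add: fdet_expand_rows prod.distrib sum_distrib_left mult_ac)

lemma fdet_scale_cols: "fdet n (\<lambda>i j. c j * f i j) = (\<Prod>j<n. c j) * fdet n f"
  by (simp add: fdet_expand_cols prod.distrib sum_distrib_left mult_ac)

lemma fdet_eq_cols:
  assumes "j < n" "k < n" "j \<noteq> k" "\<And>i. i < n \<Longrightarrow> f i j = f i k"
  shows "fdet n f = 0"
  unfolding fdet_def
  by (rule det_identical_columns[of _ n j k]) (use assms in \<open>auto intro!: eq_vecI\<close>)

text \<open>The zeros from \<open>n\<close> on, in place of \<open>undefined\<close>, let a choice
  serve directly as a sequence of row lengths.\<close>

definition padded_choices :: "nat \<Rightarrow> (nat \<Rightarrow> nat set) \<Rightarrow> (nat \<Rightarrow> nat) set" where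
  "padded_choices n I = {q. (\<forall>k<n. q k \<in> I k) \<and> (\<forall>k\<ge>n. q k = 0)}"

lemma bij_betw_padded_choices:
  "bij_betw (\<lambda>g k. if k < n then g k else 0) (PiE {..<n} I) (padded_choices n I)"
  by (rule bij_betw_byWitness[where f' = "\<lambda>q. restrict q {..<n}"])
     (auto simp: padded_choices_def fun_eq_iff PiE_def Pi_def extensional_def)

lemma finite_padded_choices:
  assumes "\<And>k. k < n \<Longrightarrow> finite (I k)"
  shows "finite (padded_choices n I)"
  using bij_betw_finite[OF bij_betw_padded_choices, of n I] assms by (auto intro!: finite_PiE)

text \<open>Multilinearity in the columns: each product over columns in the Leibniz formula expands
  into a sum over choices of one summand per column, and the sums over permutations and choices are
  interchanged.\<close>

lemma fdet_sum_cols: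
  assumes "\<And>j. j < n \<Longrightarrow> finite (I j)"
  shows "fdet n (\<lambda>i j. \<Sum>e\<in>I j. f i j e) = (\<Sum>q\<in>padded_choices n I. fdet n (\<lambda>i j. f i j (q j)))"
proof -
  have "fdet n (\<lambda>i j. \<Sum>e\<in>I j. f i j e)
      = (\<Sum>p | p permutes {0..<n}. signof p * (\<Sum>g\<in>PiE {..<n} I. \<Prod>j<n. f (p j) j (g j)))"
    unfolding fdet_expand_cols using assms by (subst prod_sum_PiE) auto
  also have "\<dots> = (\<Sum>g\<in>PiE {..<n} I. fdet n (\<lambda>i j. f i j (g j)))"
    unfolding fdet_expand_cols sum_distrib_left by (rule sum.swap)
  also have "\<dots> = (\<Sum>g\<in>PiE {..<n} I. fdet n (\<lambda>i j. f i j (if j < n then g j else 0)))"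
    by (intro sum.cong fdet_cong) auto
  also have "\<dots> = (\<Sum>q\<in>padded_choices n I. fdet n (\<lambda>i j. f i j (q j)))"
    by (rule sum.reindex_bij_betw[OF bij_betw_padded_choices])
  finally show ?thesis .
qed

text \<open>The column operation is right multiplication by the lower unitriangular matrix
  \<open>?L\<close>, whose determinant is 1.\<close>

lemma fdet_subtract_next_col:
  "fdet (Suc n) (\<lambda>i j. f i j - (if j < n then c j * f i (Suc j) else 0)) = fdet (Suc n) f"
proof -
  let ?A = "mat (Suc n) (Suc n) (\<lambda>(i, j). f i j)"
  let ?L = "mat (Suc n) (Suc n) (\<lambda>(k, j). if k = j then 1 else if k = Suc j then - c j else 0)"
  let ?B = "mat (Suc n) (Suc n) (\<lambda>(i, j). f i j - (if j < n then c j * f i (Suc j) else 0))"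
  have "?A * ?L = ?B"
  proof (rule eq_matI)
    fix i j assume ij: "i < dim_row ?B" "j < dim_col ?B"
    have "(?A * ?L) $$ (i, j)
        = (\<Sum>k\<in>{0..<Suc n}. f i k * (if k = j then 1 else if k = Suc j then - c j else 0))"
      using ij by (simp add: scalar_prod_def)
    also have "\<dots> = (\<Sum>k\<in>{0..<Suc n}. (if k = j then f i k else 0) - (if k = Suc j then c j * f i k else 0))"
      by (intro sum.cong) auto
    also have "\<dots> = ?B $$ (i, j)"
      using ij by (simp add: sum_subtractf sum.delta del: sum.op_ivl_Suc)
    finally show "(?A * ?L) $$ (i, j) = ?B $$ (i, j)" .
  qed auto
  moreover have "det (?A * ?L) = det ?A * det ?L"
    by (rule det_mult) auto
  moreover have "det ?L = 1"
  proof -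
    have "det ?L = prod_list (diag_mat ?L)"
      by (rule det_lower_triangular[of "Suc n"]) auto
    also have "diag_mat ?L = map (\<lambda>_. 1) [0..<Suc n]"
      unfolding diag_mat_def by (auto simp del: upt_Suc)
    also have "prod_list \<dots> = 1"
      by (induction n) auto
    finally show ?thesis .
  qed
  ultimately show ?thesis by (simp add: fdet_def)
qed

lemma fdet_last_row:
  assumes "\<And>j. j < n \<Longrightarrow> f n j = 0"
  shows "fdet (Suc n) f = f n n * fdet n f"
proof -
  let ?A = "mat (Suc n) (Suc n) (\<lambda>(i, j). f i j)"
  have "det ?A = (\<Sum>j<Suc n. ?A $$ (n, j) * cofactor ?A n j)"
    by (rule laplace_expansion_row) auto
  also have "\<dots> = f n n * cofactor ?A n n"
    using assms by simp
  also have "mat_delete ?A n n = mat n n (\<lambda>(i, j). f i j)"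
    by (rule eq_matI) (auto simp: mat_delete_def)
  then have "cofactor ?A n n = fdet n f"
    by (simp add: cofactor_def fdet_def)
  finally show ?thesis by (simp add: fdet_def)
qed

text \<open>A finite geometric sum, in the form that factors the difference of two adjacent columns
  of an alternant: \<open>x\<close> and \<open>y\<close> become two variables, \<open>a\<close> and
  \<open>b\<close> two consecutive row lengths, and \<open>d\<close> the exponent shift.\<close>

lemma power_diff_sum:
  fixes x y :: "'a::comm_ring_1"
  assumes "b \<le> a"
  shows "x ^ (a + d + 1) - y ^ (a - b + 1) * x ^ (b + d)
       = (x - y) * (\<Sum>e=b..a. y ^ (a - e) * x ^ (e + d))"
  using assms
proof (induction a rule: dec_induct)
  case base
  then show ?case by (simp add: algebra_simps)
next
  case (step a)
  have *: "(\<Sum>e=b..a. y ^ (Suc a - e) * x ^ (e + d)) = y * (\<Sum>e=b..a. y ^ (a - e) * x ^ (e + d))"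
    unfolding sum_distrib_left by (intro sum.cong) (auto simp: Suc_diff_le)
  have "(x - y) * (\<Sum>e=b..Suc a. y ^ (Suc a - e) * x ^ (e + d))
      = y * ((x - y) * (\<Sum>e=b..a. y ^ (a - e) * x ^ (e + d))) + (x - y) * x ^ (Suc a + d)"
    using step.hyps by (simp add: * distrib_left mult.left_commute)
  also have "\<dots> = x ^ (Suc a + d + 1) - y ^ (Suc a - b + 1) * x ^ (b + d)"
    unfolding step.IH[symmetric] using step.hyps by (simp add: algebra_simps Suc_diff_le)
  finally show ?case by simp
qed

section \<open>Alternants and their branching rule\<close>

definition alternant :: "(nat \<Rightarrow> 'a::comm_ring_1) \<Rightarrow> nat \<Rightarrow> (nat \<Rightarrow> nat) \<Rightarrow> 'a" where
  "alternant x n p = fdet n (\<lambda>i j. x i ^ (p j + (n - Suc j)))"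

text \<open>Subtracting multiples of adjacent columns clears the last row up to its corner and
  leaves a factor \<open>x i - x n\<close> in every other row \<open>i\<close>. Column
  \<open>j\<close> then is a sum over exponents between \<open>p (Suc j)\<close> and
  \<open>p j\<close>, and multilinearity turns these choices into the shapes \<open>q\<close>
  interlacing with \<open>p\<close>.\<close>

lemma alternant_branching:
  assumes "\<And>j. j < n \<Longrightarrow> p (Suc j) \<le> p j"
  shows "alternant x (Suc n) p = (\<Prod>i<n. x i - x n) *
    (\<Sum>q\<in>padded_choices n (\<lambda>j. {p (Suc j)..p j}).
       x n ^ (\<Sum>j<Suc n. p j - q j) * alternant x n q)"
proof -
  \<comment> \<open>The quotient of the entries of row \<open>n\<close> in columns \<open>j\<close>
    and \<open>Suc j\<close>; the \<open>+ 1\<close> comes from the staircase part of the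
    exponents.\<close>
  define c where "c j = x n ^ (p j - p (Suc j) + 1)" for j
  define I where "I j = {p (Suc j)..p j}" for j
  let ?f = "\<lambda>i j. x i ^ (p j + (Suc n - Suc j))"
  let ?g = "\<lambda>i j. ?f i j - (if j < n then c j * ?f i (Suc j) else 0)"
  have g: "?g i j = (x i - x n) * (\<Sum>e\<in>I j. x n ^ (p j - e) * x i ^ (e + (n - Suc j)))"
    if "j < n" for i j
  proof -
    have "n - j = Suc (n - Suc j)" using that by simp
    then show ?thesis
      using power_diff_sum[OF assms[OF that], of "x i" "n - Suc j" "x n"] that
      by (simp add: c_def I_def)
  qed
  have "alternant x (Suc n) p = fdet (Suc n) ?g"
    unfolding alternant_def by (rule fdet_subtract_next_col[symmetric])
  also have "\<dots> = ?g n n * fdet n ?g"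
  proof (rule fdet_last_row)
    show "?g n j = 0" if "j < n" for j
      using g[OF that, of n] by simp
  qed
  also have "fdet n ?g = fdet n (\<lambda>i j. (x i - x n) * (\<Sum>e\<in>I j. x n ^ (p j - e) * x i ^ (e + (n - Suc j))))"
    by (rule fdet_cong, rule g)
  also have "\<dots> = (\<Prod>i<n. x i - x n) *
      (\<Sum>q\<in>padded_choices n I. fdet n (\<lambda>i j. x n ^ (p j - q j) * x i ^ (q j + (n - Suc j))))"
    by (subst fdet_scale_rows, subst fdet_sum_cols) (auto simp: I_def)
  also have "\<dots> = (\<Prod>i<n. x i - x n) *
      (\<Sum>q\<in>padded_choices n I. x n ^ (\<Sum>j<n. p j - q j) * alternant x n q)"
    by (simp add: fdet_scale_cols alternant_def power_sum)
  \<comment> \<open>The corner entry is \<open>x n ^ p n\<close>; since \<open>q n = 0\<close>, it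
    supplies the summand \<open>j = n\<close> of the exponent.\<close>
  also have "?g n n * \<dots> = (\<Prod>i<n. x i - x n) *
      (\<Sum>q\<in>padded_choices n I. x n ^ (\<Sum>j<Suc n. p j - q j) * alternant x n q)"
    unfolding sum_distrib_left
    by (rule sum.cong) (auto simp: padded_choices_def power_add mult_ac)
  finally show ?thesis by (simp add: I_def[abs_def])
qed

definition vandermonde :: "(nat \<Rightarrow> 'a::comm_ring_1) \<Rightarrow> nat \<Rightarrow> 'a" where
  "vandermonde x n = (\<Prod>j<n. \<Prod>i<j. x i - x j)"

text \<open>This is the alternant of the empty shape. Its branching sum has only the term
  \<open>q = 0\<close>, so each step contributes exactly the differences with the new
  variable.\<close>

lemma fdet_vandermonde: "fdet n (\<lambda>i j. x i ^ (n - Suc j)) = vandermonde x n"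
proof -
  have "alternant x n (\<lambda>_. 0) = vandermonde x n"
  proof (induction n)
    case 0
    show ?case by (simp add: alternant_def vandermonde_def fdet_def)
  next
    case (Suc n)
    have "padded_choices n (\<lambda>j. {0..0}) = {\<lambda>_. 0}"
      by (auto simp: padded_choices_def) (metis not_le)
    with alternant_branching[of n "\<lambda>_. 0" x] Suc show ?case
      by (simp add: vandermonde_def mult_ac)
  qed
  then show ?thesis by (simp add: alternant_def)
qed

section \<open>The bialternant formula\<close>

definition boxes :: "(nat \<Rightarrow> nat) \<Rightarrow> (nat \<times> nat) set" where
  "boxes p = {(i, j). 1 \<le> i \<and> 1 \<le> j \<and> j \<le> p (i - 1)}"

text \<open>Inverse of \<open>boxes\<close> on diagrams; the argument counts rows from 0, while
  boxes count them from 1.\<close>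

definition row_lengths :: "(nat \<times> nat) set \<Rightarrow> nat \<Rightarrow> nat" where
  "row_lengths B k = card {j. (Suc k, j) \<in> B}"

lemma Suc_in_boxes: "(Suc k, j) \<in> boxes p \<longleftrightarrow> 1 \<le> j \<and> j \<le> p k"
  by (auto simp: boxes_def)

lemma boxes_cases:
  assumes "b \<in> boxes p"
  obtains k j where "b = (Suc k, j)" "1 \<le> j" "j \<le> p k"
  using assms by (cases b; cases "fst b") (auto simp: boxes_def)

lemma row_lengths_boxes [simp]: "row_lengths (boxes p) = p"
proof
  fix k
  have "{j. (Suc k, j) \<in> boxes p} = {1..p k}" by (auto simp: boxes_def)
  then show "row_lengths (boxes p) k = p k" by (simp add: row_lengths_def)
qed

lemma boxes_subset_iff: "boxes p \<subseteq> boxes q \<longleftrightarrow> p \<le> q"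
proof
  assume sub: "boxes p \<subseteq> boxes q"
  show "p \<le> q"
  proof (rule le_funI)
    fix k
    show "p k \<le> q k"
      using subsetD[OF sub, of "(Suc k, p k)"] by (cases "p k = 0") (auto simp: Suc_in_boxes)
  qed
next
  assume "p \<le> q"
  then show "boxes p \<subseteq> boxes q"
    by (auto simp: boxes_def le_fun_def intro: order_trans)
qed

lemma boxes_eq_iff: "boxes p = boxes q \<longleftrightarrow> p = q"
  by (metis row_lengths_boxes)

text \<open>Recognizes as diagrams the sets of boxes cut out by a bound on the entries. Each
  nonempty row is \<open>{1..M}\<close> with \<open>M\<close> its largest column, which exists by
  finiteness.\<close>

lemma left_justified_eq_boxes:
  assumes "finite B"
    and pos: "\<And>i j. (i, j) \<in> B \<Longrightarrow> 1 \<le> i \<and> 1 \<le> j"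
    and left: "\<And>i j j'. (i, j) \<in> B \<Longrightarrow> 1 \<le> j' \<Longrightarrow> j' \<le> j \<Longrightarrow> (i, j') \<in> B"
  shows "B = boxes (row_lengths B)"
proof -
  have row: "{j. (Suc k, j) \<in> B} = {1..row_lengths B k}" for k
  proof (cases "{j. (Suc k, j) \<in> B} = {}")
    case True
    then show ?thesis by (simp add: row_lengths_def)
  next
    case False
    let ?S = "{j. (Suc k, j) \<in> B}"
    have fin: "finite ?S"
      by (rule finite_subset[OF _ finite_imageI[OF assms(1), of snd]]) force
    define M where "M = Max ?S"
    have M: "(Suc k, M) \<in> B" "\<And>j. (Suc k, j) \<in> B \<Longrightarrow> j \<le> M"
      using Max_in[OF fin False] Max_ge[OF fin] by (auto simp: M_def)
    have S: "?S = {1..M}"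
    proof (rule Set.set_eqI, rule iffI)
      fix j assume "j \<in> {1..M}"
      then show "j \<in> ?S" using left[OF M(1), of j] by simp
    next
      fix j assume "j \<in> ?S"
      then show "j \<in> {1..M}" using M(2)[of j] pos[of "Suc k" j] by simp
    qed
    then show ?thesis by (simp add: row_lengths_def)
  qed
  show ?thesis
  proof (rule Set.set_eqI)
    fix b :: "nat \<times> nat"
    obtain i j where b: "b = (i, j)" by (cases b)
    show "b \<in> B \<longleftrightarrow> b \<in> boxes (row_lengths B)"
    proof (cases i)
      case 0
      then show ?thesis using pos[of i j] b by (auto simp: boxes_def)
    next
      case (Suc k)
      have "j \<in> {j. (Suc k, j) \<in> B} \<longleftrightarrow> j \<in> {1..row_lengths B k}"
        by (simp only: row)
      then show ?thesis by (simp add: b Suc Suc_in_boxes)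
    qed
  qed
qed

lemma boxes_diff_conv_Sigma:
  assumes "\<forall>k\<ge>n. p k = 0"
  shows "boxes p - boxes q = (\<lambda>(k, j). (Suc k, j)) ` (SIGMA k:{..<n}. {q k<..p k})"
proof (rule subset_antisym; rule subsetI)
  fix b assume "b \<in> boxes p - boxes q"
  then obtain k j where b: "b = (Suc k, j)" "1 \<le> j" "j \<le> p k" "\<not> j \<le> q k"
    by (auto elim!: boxes_cases simp: Suc_in_boxes)
  moreover have "k < n" using assms b by (cases "k < n") auto
  ultimately show "b \<in> (\<lambda>(k, j). (Suc k, j)) ` (SIGMA k:{..<n}. {q k<..p k})"
    by (intro image_eqI[of _ _ "(k, j)"]) auto
qed (auto simp: Suc_in_boxes)

lemma card_boxes_diff:
  assumes "\<forall>k\<ge>n. p k = 0"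
  shows "card (boxes p - boxes q) = (\<Sum>k<n. p k - q k)"
proof -
  have "inj_on (\<lambda>(k, j). (Suc k, j)) (SIGMA k:{..<n}. {q k<..p k})"
    by (auto simp: inj_on_def)
  then show ?thesis
    unfolding boxes_diff_conv_Sigma[OF assms] by (simp add: card_image)
qed

lemma finite_boxes:
  assumes "\<forall>k\<ge>n. p k = 0"
  shows "finite (boxes p)"
proof -
  have "finite (boxes p - boxes (\<lambda>_. 0))"
    unfolding boxes_diff_conv_Sigma[OF assms] by auto
  moreover have "boxes (\<lambda>_. 0) = {}" by (auto simp: boxes_def)
  ultimately show ?thesis by simp
qed

section \<open>Tableaux and fillings on a set of boxes\<close>

definition tableaux_on :: "nat \<Rightarrow> (nat \<times> nat) set \<Rightarrow> (nat \<times> nat \<Rightarrow> nat) set" where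
  "tableaux_on n B =
    {T \<in> B \<rightarrow>\<^sub>E {1..n}.
       (\<forall>i j j'. (i, j) \<in> B \<longrightarrow> (i, j') \<in> B \<longrightarrow> j < j' \<longrightarrow> T (i, j) \<le> T (i, j')) \<and>
       (\<forall>i i' j. (i, j) \<in> B \<longrightarrow> (i', j) \<in> B \<longrightarrow> i < i' \<longrightarrow> T (i, j) < T (i', j))}"

definition fillings_on :: "nat \<Rightarrow> (nat \<times> nat) set \<Rightarrow> (nat \<times> nat \<Rightarrow> nat) set" where
  "fillings_on n B =
    {T \<in> (\<Pi>\<^sub>E b\<in>B. {1..n - fst b}).
       (\<forall>i j j'. (i, j) \<in> B \<longrightarrow> (i, j') \<in> B \<longrightarrow> j < j' \<longrightarrow> T (i, j) > T (i, j')) \<and>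
       (\<forall>i i' j. (i, j) \<in> B \<longrightarrow> (i', j) \<in> B \<longrightarrow> i < i' \<longrightarrow> T (i, j) \<ge> T (i', j))}"

lemma finite_tableaux_on: "finite B \<Longrightarrow> finite (tableaux_on n B)"
  unfolding tableaux_on_def
  by (rule finite_subset[OF _ finite_PiE[of B "\<lambda>_. {1..n}"]]) auto

lemma finite_fillings_on: "finite B \<Longrightarrow> finite (fillings_on n B)"
  unfolding fillings_on_def
  by (rule finite_subset[OF _ finite_PiE[of B "\<lambda>b. {1..n - fst b}"]]) auto

text \<open>Entries are positive and strictly increase down a column. This bounds the number of rows
  in which small entries can stand.\<close>

lemma row_le_entry:
  assumes T: "T \<in> tableaux_on n (boxes p)" and p: "antimono p"
  shows "(Suc k, j) \<in> boxes p \<Longrightarrow> Suc k \<le> T (Suc k, j)"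
proof (induction k)
  case 0
  then show ?case using T by (force simp: tableaux_on_def)
next
  case (Suc k)
  have "(Suc k, j) \<in> boxes p"
    using Suc.prems antimonoD[OF p, of k "Suc k"] by (auto simp: Suc_in_boxes)
  moreover have "T (Suc k, j) < T (Suc (Suc k), j)"
    using T Suc.prems \<open>(Suc k, j) \<in> boxes p\<close> by (auto simp: tableaux_on_def)
  ultimately show ?case using Suc.IH by simp
qed

text \<open>The entries of a row are distinct elements of \<open>{1..n - Suc k}\<close>, so the flag
  condition by itself keeps a filled shape inside the staircase.\<close>

lemma row_length_le_flag:
  assumes "T \<in> fillings_on n (boxes p)"
  shows "p k \<le> n - Suc k"
proof -
  have "inj_on (\<lambda>j. T (Suc k, j)) {1..p k}"
  proof (rule linorder_inj_onI')
    fix i j assume "i \<in> {1..p k}" "j \<in> {1..p k}" "i < j"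
    then have "T (Suc k, i) > T (Suc k, j)"
      using assms by (auto simp: fillings_on_def Suc_in_boxes)
    then show "T (Suc k, i) \<noteq> T (Suc k, j)" by simp
  qed
  moreover have "(\<lambda>j. T (Suc k, j)) ` {1..p k} \<subseteq> {1..n - Suc k}"
  proof (rule image_subsetI)
    fix j assume "j \<in> {1..p k}"
    then have "(Suc k, j) \<in> boxes p" by (simp add: Suc_in_boxes)
    moreover have "T \<in> (\<Pi>\<^sub>E b\<in>boxes p. {1..n - fst b})"
      using assms by (simp add: fillings_on_def)
    ultimately show "T (Suc k, j) \<in> {1..n - Suc k}" by (auto dest: PiE_mem)
  qed
  ultimately have "card {1..p k} \<le> card {1..n - Suc k}"
    by (intro card_inj_on_le) auto
  then show ?thesis by simp
qed

definition schur_on :: "nat \<Rightarrow> (nat \<Rightarrow> nat) \<Rightarrow> mpoly_int" where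
  "schur_on n p = (\<Sum>T\<in>tableaux_on n (boxes p). \<Prod>b\<in>boxes p. X (T b))"

definition filling_count :: "nat \<Rightarrow> (nat \<Rightarrow> nat) \<Rightarrow> nat" where
  "filling_count n p = card (fillings_on n (boxes p))"

section \<open>Branching rule of Schur polynomials\<close>

definition small_part :: "nat \<Rightarrow> (nat \<Rightarrow> nat) \<Rightarrow> (nat \<times> nat \<Rightarrow> nat) \<Rightarrow> (nat \<times> nat) set" where
  "small_part n p T = {b \<in> boxes p. T b \<le> n}"

text \<open>Rows weakly increase, so the entries up to \<open>n\<close> are left-justified. Columns
  strictly increase, so an entry above another one is at most \<open>n\<close>; this gives the
  interlacing inequality \<open>p (Suc k) <= q k\<close>.\<close>

lemma small_part_eq_boxes:
  assumes T: "T \<in> tableaux_on (Suc n) (boxes p)" and p: "antimono p"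
    and p0: "\<forall>k\<ge>Suc n. p k = 0"
  defines "q \<equiv> row_lengths (small_part n p T)"
  shows "small_part n p T = boxes q" "q \<in> padded_choices n (\<lambda>j. {p (Suc j)..p j})"
proof -
  have fin: "finite (boxes p)" by (rule finite_boxes[OF p0])
  show eq: "small_part n p T = boxes q"
    unfolding q_def
  proof (rule left_justified_eq_boxes)
    fix i j j' assume *: "(i, j) \<in> small_part n p T" "1 \<le> j'" "j' \<le> j"
    then have "(i, j') \<in> boxes p" by (auto simp: small_part_def boxes_def)
    moreover have "T (i, j') \<le> T (i, j)"
      using T * \<open>(i, j') \<in> boxes p\<close>
      by (cases "j' = j") (auto simp: tableaux_on_def small_part_def)
    ultimately show "(i, j') \<in> small_part n p T" using * by (auto simp: small_part_def)
  qed (use fin in \<open>auto simp: small_part_def boxes_def\<close>)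
  have le: "q k \<le> p k" for k
    using boxes_subset_iff[of q p] eq by (auto simp: small_part_def le_fun_def)
  have ge: "p (Suc k) \<le> q k" for k
  proof (cases "p (Suc k) = 0")
    case False
    let ?j = "p (Suc k)"
    have b: "(Suc (Suc k), ?j) \<in> boxes p" "(Suc k, ?j) \<in> boxes p"
      using False antimonoD[OF p, of k "Suc k"] by (auto simp: Suc_in_boxes)
    then have "T (Suc k, ?j) < T (Suc (Suc k), ?j)" "T (Suc (Suc k), ?j) \<le> Suc n"
      using T by (auto simp: tableaux_on_def)
    then have "(Suc k, ?j) \<in> small_part n p T"
      using b by (simp add: small_part_def)
    then have "(Suc k, ?j) \<in> boxes q" by (simp only: eq)
    then show ?thesis by (simp add: Suc_in_boxes)
  qed simp
  \<comment> \<open>Entries of row \<open>Suc k\<close> are at least \<open>Suc k\<close>, hence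
    exceed \<open>n\<close>.\<close>
  have "q k = 0" if "k \<ge> n" for k
  proof (rule ccontr)
    assume "q k \<noteq> 0"
    then have "(Suc k, 1) \<in> small_part n p T" by (auto simp: eq Suc_in_boxes)
    then have "(Suc k, 1) \<in> boxes p" "T (Suc k, 1) \<le> n" by (auto simp: small_part_def)
    with row_le_entry[OF T p, of k 1] that show False by simp
  qed
  with le ge show "q \<in> padded_choices n (\<lambda>j. {p (Suc j)..p j})"
    by (auto simp: padded_choices_def)
qed

text \<open>The inverse puts \<open>Suc n\<close> into all boxes of \<open>p\<close> outside
  \<open>q\<close>. Interlacing makes these boxes a horizontal strip: none of them lies above
  another box of \<open>p\<close>, so columns stay strict.\<close>

lemma tableaux_with_small_part:
  assumes q: "q \<in> padded_choices n (\<lambda>j. {p (Suc j)..p j})" and p: "antimono p"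
    and p0: "\<forall>k\<ge>Suc n. p k = 0"
  shows "bij_betw (\<lambda>T. restrict T (boxes q))
    {T \<in> tableaux_on (Suc n) (boxes p). small_part n p T = boxes q} (tableaux_on n (boxes q))"
proof (rule bij_betw_byWitness[where f' = "\<lambda>T b. if b \<in> boxes q then T b else
    if b \<in> boxes p then Suc n else undefined"])
  let ?ext = "\<lambda>T b. if b \<in> boxes q then T b else if b \<in> boxes p then Suc n else undefined"
  have le: "q k \<le> p k" for k
    using q p0[rule_format, of k] by (cases "k < n") (auto simp: padded_choices_def)
  have ge: "p (Suc k) \<le> q k" for k
    using q p0[rule_format, of "Suc k"] by (cases "k < n") (auto simp: padded_choices_def)
  have sub: "boxes q \<subseteq> boxes p" using le by (simp add: boxes_subset_iff le_fun_def)
  have above: "(i, j) \<in> boxes q" if ij: "(i, j) \<in> boxes p" "(i', j) \<in> boxes p" "i < i'" for i i' j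
  proof -
    obtain k where k: "i = Suc k" "1 \<le> j" using ij(1) by (blast elim: boxes_cases)
    obtain k' where k': "i' = Suc k'" "j \<le> p k'" using ij(2) by (blast elim: boxes_cases)
    have "j \<le> p (Suc k)" using k k' ij(3) antimonoD[OF p, of "Suc k" k'] by simp
    then show ?thesis using ge[of k] k by (simp add: Suc_in_boxes)
  qed
  have left: "(i, j) \<in> boxes q" if "(i, j) \<in> boxes p" "(i, j') \<in> boxes q" "j < j'" for i j j'
    using that by (auto simp: boxes_def)
  show "\<forall>T\<in>{T \<in> tableaux_on (Suc n) (boxes p). small_part n p T = boxes q}.
      ?ext (restrict T (boxes q)) = T"
  proof safe
    fix T assume T: "T \<in> tableaux_on (Suc n) (boxes p)" "small_part n p T = boxes q"
    have "T b = Suc n" if "b \<in> boxes p" "b \<notin> boxes q" for b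
    proof -
      have "\<not> T b \<le> n" using that T(2) by (auto simp: small_part_def)
      moreover have "T b \<le> Suc n" using that T(1) by (force simp: tableaux_on_def)
      ultimately show ?thesis by simp
    qed
    moreover have "T b = undefined" if "b \<notin> boxes p" for b
      using that T(1) by (auto simp: tableaux_on_def)
    ultimately show "?ext (restrict T (boxes q)) = T" by (auto simp: fun_eq_iff)
  qed
  show "\<forall>T\<in>tableaux_on n (boxes q). restrict (?ext T) (boxes q) = T"
    by (auto simp: fun_eq_iff tableaux_on_def restrict_def PiE_def extensional_def)
  show "(\<lambda>T. restrict T (boxes q)) ` {T \<in> tableaux_on (Suc n) (boxes p). small_part n p T = boxes q}
      \<subseteq> tableaux_on n (boxes q)"
  proof safe
    fix T assume T: "T \<in> tableaux_on (Suc n) (boxes p)" "small_part n p T = boxes q"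
    have "T b \<in> {1..n}" if "b \<in> boxes q" for b
    proof -
      have "T b \<le> n" "b \<in> boxes p" using that T(2) by (auto simp: small_part_def)
      then show ?thesis using T(1) by (force simp: tableaux_on_def)
    qed
    then show "restrict T (boxes q) \<in> tableaux_on n (boxes q)"
      using T(1) by (simp add: tableaux_on_def) (meson sub subsetD)
  qed
  show "?ext ` tableaux_on n (boxes q)
      \<subseteq> {T \<in> tableaux_on (Suc n) (boxes p). small_part n p T = boxes q}"
  proof (rule image_subsetI)
    fix T assume T: "T \<in> tableaux_on n (boxes q)"
    have rng: "1 \<le> T b \<and> T b \<le> n" if "b \<in> boxes q" for b
      using T that by (force simp: tableaux_on_def)
    have "small_part n p (?ext T) = boxes q"
      using rng sub by (auto simp: small_part_def)
    moreover have "?ext T \<in> boxes p \<rightarrow>\<^sub>E {1..Suc n}"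
      using rng sub by (force simp: PiE_def extensional_def)
    moreover have "?ext T (i, j) \<le> ?ext T (i, j')"
      if "(i, j) \<in> boxes p" "(i, j') \<in> boxes p" "j < j'" for i j j'
      using that left[of i j j'] T rng[of "(i, j)"] by (auto simp: tableaux_on_def)
    moreover have "?ext T (i, j) < ?ext T (i', j)"
      if "(i, j) \<in> boxes p" "(i', j) \<in> boxes p" "i < i'" for i i' j
      using that above[of i j i'] T rng[of "(i, j)"] by (auto simp: tableaux_on_def)
    ultimately show "?ext T \<in> {T \<in> tableaux_on (Suc n) (boxes p). small_part n p T = boxes q}"
      by (simp add: tableaux_on_def)
  qed
qed

text \<open>The tableaux are grouped by the shape \<open>q\<close> of their entries up to
  \<open>n\<close>; every box outside \<open>q\<close> contributes a factor
  \<open>X (Suc n)\<close>.\<close>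

lemma schur_on_branching:
  assumes p: "antimono p" and p0: "\<forall>k\<ge>Suc n. p k = 0"
  shows "schur_on (Suc n) p = (\<Sum>q\<in>padded_choices n (\<lambda>j. {p (Suc j)..p j}).
    X (Suc n) ^ (\<Sum>j<Suc n. p j - q j) * schur_on n q)"
proof -
  let ?Q = "padded_choices n (\<lambda>j. {p (Suc j)..p j})"
  let ?Tab = "tableaux_on (Suc n) (boxes p)"
  have fin: "finite (boxes p)" by (rule finite_boxes[OF p0])
  have "schur_on (Suc n) p = (\<Sum>q\<in>?Q. \<Sum>T\<in>{T \<in> ?Tab. row_lengths (small_part n p T) = q}.
      \<Prod>b\<in>boxes p. X (T b))"
    unfolding schur_on_def
    by (rule sum.group[symmetric])
       (use small_part_eq_boxes(2)[OF _ p p0] in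
         \<open>auto intro!: finite_tableaux_on fin finite_padded_choices\<close>)
  also have "\<dots> = (\<Sum>q\<in>?Q. X (Suc n) ^ (\<Sum>j<Suc n. p j - q j) * schur_on n q)"
  proof (rule sum.cong)
    fix q assume q: "q \<in> ?Q"
    have "q k \<le> p k" for k
      using q p0[rule_format, of k] by (cases "k < n") (auto simp: padded_choices_def)
    then have sub: "boxes q \<subseteq> boxes p" by (simp add: boxes_subset_iff le_fun_def)
    have "{T \<in> ?Tab. row_lengths (small_part n p T) = q}
        = {T \<in> ?Tab. small_part n p T = boxes q}"
      using small_part_eq_boxes(1)[OF _ p p0] by (auto simp: boxes_eq_iff)
    moreover have "(\<Prod>b\<in>boxes p. X (T b))
        = X (Suc n) ^ (\<Sum>j<Suc n. p j - q j) * (\<Prod>b\<in>boxes q. X (restrict T (boxes q) b))"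
      if T: "T \<in> ?Tab" "small_part n p T = boxes q" for T
    proof -
      have "T b = Suc n" if "b \<in> boxes p - boxes q" for b
      proof -
        have "\<not> T b \<le> n" using that T(2) by (auto simp: small_part_def)
        moreover have "T b \<le> Suc n" using that T(1) by (force simp: tableaux_on_def)
        ultimately show ?thesis by simp
      qed
      then have "(\<Prod>b\<in>boxes p - boxes q. X (T b)) = X (Suc n) ^ card (boxes p - boxes q)"
        by simp
      then show ?thesis
        using prod.subset_diff[OF sub fin, of "\<lambda>b. X (T b)"] card_boxes_diff[OF p0, of q]
        by (simp add: mult_ac)
    qed
    ultimately have "(\<Sum>T\<in>{T \<in> ?Tab. row_lengths (small_part n p T) = q}. \<Prod>b\<in>boxes p. X (T b))
        = (\<Sum>T\<in>{T \<in> ?Tab. small_part n p T = boxes q}. X (Suc n) ^ (\<Sum>j<Suc n. p j - q j) *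
             (\<Prod>b\<in>boxes q. X (restrict T (boxes q) b)))"
      by (intro sum.cong) auto
    also have "\<dots> = X (Suc n) ^ (\<Sum>j<Suc n. p j - q j) * schur_on n q"
      unfolding schur_on_def sum_distrib_left
      by (rule sum.reindex_bij_betw[OF tableaux_with_small_part[OF q p p0]])
    finally show "(\<Sum>T\<in>{T \<in> ?Tab. row_lengths (small_part n p T) = q}. \<Prod>b\<in>boxes p. X (T b))
        = X (Suc n) ^ (\<Sum>j<Suc n. p j - q j) * schur_on n q" .
  qed simp
  finally show ?thesis .
qed

text \<open>Induction on the number of variables: alternants and Schur polynomials have the same
  branching sum, and the extra product of differences in the alternant is what the Vandermonde
  determinant gains.\<close>

lemma bialternant:
  assumes "antimono p" "\<forall>k\<ge>n. p k = 0"
  shows "alternant (\<lambda>i. X (Suc i)) n p = schur_on n p * vandermonde (\<lambda>i. X (Suc i)) n"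
  using assms
proof (induction n arbitrary: p)
  case 0
  then have "p = (\<lambda>_. 0)" by auto
  then have "boxes p = {}" by (auto simp: boxes_def)
  moreover have "tableaux_on 0 {} = {\<lambda>_. undefined}" by (auto simp: tableaux_on_def)
  ultimately show ?case
    by (simp add: schur_on_def alternant_def vandermonde_def fdet_def)
next
  case (Suc n)
  let ?x = "\<lambda>i. X (Suc i)"
  let ?Q = "padded_choices n (\<lambda>j. {p (Suc j)..p j})"
  \<comment> \<open>Interlacing passes monotonicity on:
    \<open>q (Suc k) <= p (Suc k) <= q k\<close>, so the induction hypothesis applies to
    \<open>q\<close>.\<close>
  have q: "antimono q \<and> (\<forall>k\<ge>n. q k = 0)" if "q \<in> ?Q" for q
  proof -
    have "q (Suc k) \<le> q k" for k
    proof (cases "Suc k < n")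
      case True
      then have "q (Suc k) \<le> p (Suc k)" "p (Suc k) \<le> q k"
        using that by (auto simp: padded_choices_def)
      then show ?thesis by simp
    qed (use that in \<open>auto simp: padded_choices_def\<close>)
    then show ?thesis using that by (auto simp: antimono_iff_le_Suc padded_choices_def)
  qed
  have "alternant ?x (Suc n) p = (\<Prod>i<n. ?x i - ?x n) *
      (\<Sum>q\<in>?Q. ?x n ^ (\<Sum>j<Suc n. p j - q j) * alternant ?x n q)"
    by (rule alternant_branching) (use Suc.prems in \<open>auto simp: antimono_iff_le_Suc\<close>)
  also have "(\<Sum>q\<in>?Q. ?x n ^ (\<Sum>j<Suc n. p j - q j) * alternant ?x n q)
      = (\<Sum>q\<in>?Q. ?x n ^ (\<Sum>j<Suc n. p j - q j) * schur_on n q) * vandermonde ?x n"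
    unfolding sum_distrib_right
  proof (rule sum.cong)
    fix q assume "q \<in> ?Q"
    then have "alternant ?x n q = schur_on n q * vandermonde ?x n"
      using q[of q] Suc.IH[of q] by blast
    then show "?x n ^ (\<Sum>j<Suc n. p j - q j) * alternant ?x n q
        = ?x n ^ (\<Sum>j<Suc n. p j - q j) * schur_on n q * vandermonde ?x n"
      by (simp only: mult.assoc)
  qed simp
  also have "(\<Sum>q\<in>?Q. ?x n ^ (\<Sum>j<Suc n. p j - q j) * schur_on n q) = schur_on (Suc n) p"
    using Suc.prems by (intro schur_on_branching[symmetric]) auto
  finally show ?case by (simp add: vandermonde_def mult_ac)
qed

section \<open>Recurrence for reverse flagged fillings\<close>

text \<open>Containment is part of this notion, unlike in \<open>vertical_strip\<close>.\<close>

definition vstrip :: "(nat \<Rightarrow> nat) \<Rightarrow> (nat \<Rightarrow> nat) \<Rightarrow> bool" where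
  "vstrip q p \<longleftrightarrow> q \<le> p \<and> (\<forall>k. p k \<le> Suc (q k))"

definition large_part :: "(nat \<Rightarrow> nat) \<Rightarrow> (nat \<times> nat \<Rightarrow> nat) \<Rightarrow> (nat \<times> nat) set" where
  "large_part p T = {b \<in> boxes p. 1 < T b}"

text \<open>Strict decrease along rows leaves at most one entry 1 per row, at the right end, so the
  boxes with 1 form a vertical strip. Weak decrease down columns makes the larger entries occupy a
  partition shape.\<close>

lemma large_part_eq_boxes:
  assumes T: "T \<in> fillings_on n (boxes p)" and p: "antimono p" and fin: "finite (boxes p)"
  defines "q \<equiv> row_lengths (large_part p T)"
  shows "large_part p T = boxes q" "antimono q" "vstrip q p"
proof -
  have pos: "1 \<le> T b" if "b \<in> boxes p" for b
    using T that by (force simp: fillings_on_def)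
  show eq: "large_part p T = boxes q"
    unfolding q_def
  proof (rule left_justified_eq_boxes)
    fix i j j' assume *: "(i, j) \<in> large_part p T" "1 \<le> j'" "j' \<le> j"
    then have "(i, j') \<in> boxes p" by (auto simp: large_part_def boxes_def)
    moreover have "T (i, j') \<ge> T (i, j)"
      using T * \<open>(i, j') \<in> boxes p\<close>
      by (cases "j' = j") (auto simp: fillings_on_def large_part_def intro: less_imp_le)
    ultimately show "(i, j') \<in> large_part p T" using * by (auto simp: large_part_def)
  qed (use fin in \<open>auto simp: large_part_def boxes_def\<close>)
  have le: "q k \<le> p k" for k
    using boxes_subset_iff[of q p] eq by (auto simp: large_part_def le_fun_def)
  have "q (Suc k) \<le> q k" for k
  proof (cases "q (Suc k) = 0")
    case False
    let ?j = "q (Suc k)"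
    have "(Suc (Suc k), ?j) \<in> boxes q" using False by (simp add: Suc_in_boxes)
    then have b: "(Suc (Suc k), ?j) \<in> boxes p" "1 < T (Suc (Suc k), ?j)"
      by (auto simp: eq[symmetric] large_part_def)
    then have b': "(Suc k, ?j) \<in> boxes p"
      using antimonoD[OF p, of k "Suc k"] by (auto simp: Suc_in_boxes)
    then have "T (Suc (Suc k), ?j) \<le> T (Suc k, ?j)"
      using T b by (auto simp: fillings_on_def)
    then have "(Suc k, ?j) \<in> boxes q"
      using b b' by (auto simp: eq[symmetric] large_part_def)
    then show ?thesis by (simp add: Suc_in_boxes)
  qed simp
  then show "antimono q" by (simp add: antimono_iff_le_Suc)
  have "p k \<le> Suc (q k)" for k
  proof (cases "p k \<le> 1")
    case False
    \<comment> \<open>The last entry of the row is at least 1, so the one before it is larger than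
      1.\<close>
    let ?j = "p k - 1"
    have b: "(Suc k, ?j) \<in> boxes p" "(Suc k, p k) \<in> boxes p" "?j < p k"
      using False by (auto simp: Suc_in_boxes)
    then have "T (Suc k, p k) < T (Suc k, ?j)"
      using T by (auto simp: fillings_on_def)
    then have "(Suc k, ?j) \<in> boxes q"
      using b pos[of "(Suc k, p k)"] by (auto simp: eq[symmetric] large_part_def)
    then have "p k - 1 \<le> q k" by (simp only: Suc_in_boxes)
    then show ?thesis by linarith
  qed simp
  with le show "vstrip q p" by (auto simp: vstrip_def le_fun_def)
qed

text \<open>Lowering the entries by one matches the lowering of the flag from \<open>Suc n\<close>
  to \<open>n\<close>. Conversely, entries are raised and the rest of \<open>p\<close> is filled
  with 1, at most once per row; rows stay strict since every raised entry exceeds 1.\<close>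

lemma fillings_with_large_part:
  assumes q: "antimono q" "vstrip q p" and p0: "\<forall>k\<ge>n. p k = 0"
  shows "bij_betw (\<lambda>T. restrict (\<lambda>b. T b - 1) (boxes q))
    {T \<in> fillings_on (Suc n) (boxes p). large_part p T = boxes q} (fillings_on n (boxes q))"
proof (rule bij_betw_byWitness[where f' = "\<lambda>T b. if b \<in> boxes q then Suc (T b) else
    if b \<in> boxes p then 1 else undefined"])
  let ?ext = "\<lambda>T b. if b \<in> boxes q then Suc (T b) else if b \<in> boxes p then 1 else undefined"
  let ?res = "\<lambda>T. restrict (\<lambda>b. T b - 1) (boxes q)"
  have le: "q k \<le> p k" and ge: "p k \<le> Suc (q k)" for k
    using q(2) by (auto simp: vstrip_def le_fun_def)
  have sub: "boxes q \<subseteq> boxes p" using le by (simp add: boxes_subset_iff le_fun_def)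
  have up: "(i, j) \<in> boxes q" if "(i, j) \<in> boxes p" "(i', j) \<in> boxes q" "i < i'" for i i' j
  proof -
    have "q (i' - 1) \<le> q (i - 1)" using that(3) by (intro antimonoD[OF q(1)]) simp
    then show ?thesis using that by (auto simp: boxes_def)
  qed
  have left: "(i, j) \<in> boxes q" if "(i, j) \<in> boxes p" "(i, j') \<in> boxes p" "j < j'" for i j j'
    using that ge[of "i - 1"] by (auto simp: boxes_def)
  \<comment> \<open>Nonempty rows have number at most \<open>n\<close>, so the bound
    \<open>Suc n - fst b\<close> leaves room for the entry 1.\<close>
  have flag: "fst b \<le> n" if b: "b \<in> boxes p" for b
  proof -
    obtain k j where "b = (Suc k, j)" "1 \<le> j" "j \<le> p k" using b by (rule boxes_cases)
    then show ?thesis using p0[rule_format, of k] by (cases "n \<le> k") auto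
  qed
  show "\<forall>T\<in>{T \<in> fillings_on (Suc n) (boxes p). large_part p T = boxes q}. ?ext (?res T) = T"
  proof safe
    fix T assume T: "T \<in> fillings_on (Suc n) (boxes p)" "large_part p T = boxes q"
    have "T b = 1" if "b \<in> boxes p" "b \<notin> boxes q" for b
    proof -
      have "\<not> 1 < T b" using that T(2) by (auto simp: large_part_def)
      moreover have "1 \<le> T b" using that T(1) by (force simp: fillings_on_def)
      ultimately show ?thesis by simp
    qed
    moreover have "1 < T b" if "b \<in> boxes q" for b
      using that T(2) by (auto simp: large_part_def)
    moreover have "T b = undefined" if "b \<notin> boxes p" for b
      using that T(1) by (auto simp: fillings_on_def)
    ultimately show "?ext (?res T) = T" by (force simp: fun_eq_iff)
  qed
  show "\<forall>T\<in>fillings_on n (boxes q). ?res (?ext T) = T"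
    by (auto simp: fun_eq_iff fillings_on_def restrict_def PiE_def extensional_def)
  show "?res ` {T \<in> fillings_on (Suc n) (boxes p). large_part p T = boxes q}
      \<subseteq> fillings_on n (boxes q)"
  proof safe
    fix T assume T: "T \<in> fillings_on (Suc n) (boxes p)" "large_part p T = boxes q"
    have gt: "1 < T b" if "b \<in> boxes q" for b
      using that T(2) by (auto simp: large_part_def)
    have "T b - 1 \<in> {1..n - fst b}" if "b \<in> boxes q" for b
    proof -
      have "T b \<le> Suc n - fst b" using T(1) that sub by (force simp: fillings_on_def)
      then show ?thesis using gt[OF that] by auto
    qed
    then have "?res T \<in> (\<Pi>\<^sub>E b\<in>boxes q. {1..n - fst b})" by simp
    moreover have "?res T (i, j) > ?res T (i, j')"
      if "(i, j) \<in> boxes q" "(i, j') \<in> boxes q" "j < j'" for i j j'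
    proof -
      have "(i, j) \<in> boxes p" "(i, j') \<in> boxes p" using that sub by blast+
      then have "T (i, j) > T (i, j')" using T(1) that(3) by (simp add: fillings_on_def)
      then show ?thesis using that gt[OF that(2)] by simp
    qed
    moreover have "?res T (i, j) \<ge> ?res T (i', j)"
      if "(i, j) \<in> boxes q" "(i', j) \<in> boxes q" "i < i'" for i i' j
    proof -
      have "(i, j) \<in> boxes p" "(i', j) \<in> boxes p" using that sub by blast+
      then have "T (i, j) \<ge> T (i', j)" using T(1) that(3) by (simp add: fillings_on_def)
      then show ?thesis using that by (simp add: diff_le_mono)
    qed
    ultimately show "?res T \<in> fillings_on n (boxes q)"
      unfolding fillings_on_def by blast
  qed
  show "?ext ` fillings_on n (boxes q)
      \<subseteq> {T \<in> fillings_on (Suc n) (boxes p). large_part p T = boxes q}"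
  proof (rule image_subsetI)
    fix T assume T: "T \<in> fillings_on n (boxes q)"
    have rng: "1 \<le> T b \<and> T b \<le> n - fst b" if "b \<in> boxes q" for b
      using T that by (force simp: fillings_on_def)
    have "large_part p (?ext T) = boxes q"
      using rng sub by (force simp: large_part_def)
    moreover have "?ext T \<in> (\<Pi>\<^sub>E b\<in>boxes p. {1..Suc n - fst b})"
    proof (rule PiE_I)
      fix b assume "b \<in> boxes p"
      then show "?ext T b \<in> {1..Suc n - fst b}"
        using rng[of b] flag[of b] by auto
    qed (use sub in auto)
    moreover have "?ext T (i, j) > ?ext T (i, j')"
      if "(i, j) \<in> boxes p" "(i, j') \<in> boxes p" "j < j'" for i j j'
      using that left[of i j j'] T rng[of "(i, j)"] by (auto simp: fillings_on_def)
    moreover have "?ext T (i, j) \<ge> ?ext T (i', j)"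
      if "(i, j) \<in> boxes p" "(i', j) \<in> boxes p" "i < i'" for i i' j
      using that up[of i j i'] T by (auto simp: fillings_on_def)
    ultimately show "?ext T \<in> {T \<in> fillings_on (Suc n) (boxes p). large_part p T = boxes q}"
      unfolding fillings_on_def by blast
  qed
qed

text \<open>Partitions inside the staircase of size \<open>m\<close>: with rows counted from 0, row
  \<open>k\<close> has room for \<open>m - k\<close> boxes.\<close>

definition stair_shapes :: "nat \<Rightarrow> (nat \<Rightarrow> nat) set" where
  "stair_shapes m = {p. antimono p \<and> (\<forall>k. p k \<le> m - k)}"

lemma stair_shapes_zero: "p \<in> stair_shapes m \<Longrightarrow> k \<ge> m \<Longrightarrow> p k = 0"
  by (auto simp: stair_shapes_def) (metis diff_is_0_eq le_zero_eq)

lemma finite_stair_shapes: "finite (stair_shapes m)"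
proof (rule finite_subset)
  show "stair_shapes m \<subseteq> padded_choices m (\<lambda>_. {..m})"
    using stair_shapes_zero by (auto simp: padded_choices_def stair_shapes_def intro: order_trans)
  show "finite (padded_choices m (\<lambda>_. {..m}))" by (rule finite_padded_choices) simp
qed

text \<open>Fillings are grouped by the shape of their entries above 1.\<close>

lemma filling_count_Suc:
  assumes p: "p \<in> stair_shapes (Suc m)"
  shows "filling_count (Suc (Suc m)) p =
    (\<Sum>q | q \<in> stair_shapes m \<and> vstrip q p. filling_count (Suc m) q)"
proof -
  let ?F = "fillings_on (Suc (Suc m)) (boxes p)"
  let ?Q = "{q \<in> stair_shapes m. vstrip q p}"
  have p0: "\<forall>k\<ge>Suc m. p k = 0" using stair_shapes_zero[OF p] by simp
  have anti: "antimono p" using p by (simp add: stair_shapes_def)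
  have fin: "finite (boxes p)" by (rule finite_boxes[OF p0])
  have q: "row_lengths (large_part p T) \<in> ?Q" if T: "T \<in> ?F" for T
  proof -
    note L = large_part_eq_boxes[OF T anti fin]
    \<comment> \<open>The lowered filling is a witness that its shape obeys
      \<open>row_length_le_flag\<close> and so lies in the staircase of size
      \<open>m\<close>.\<close>
    have "restrict (\<lambda>b. T b - 1) (boxes (row_lengths (large_part p T)))
        \<in> fillings_on (Suc m) (boxes (row_lengths (large_part p T)))"
      using bij_betwE[OF fillings_with_large_part[OF L(2,3) p0]] T L(1) by blast
    from row_length_le_flag[OF this] show ?thesis
      using L by (auto simp: stair_shapes_def)
  qed
  have "card ?F = (\<Sum>q\<in>?Q. \<Sum>T\<in>{T \<in> ?F. row_lengths (large_part p T) = q}. 1)"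
    unfolding card_eq_sum
    by (rule sum.group[symmetric])
       (use q finite_stair_shapes in \<open>auto intro!: finite_fillings_on fin\<close>)
  also have "\<dots> = (\<Sum>q\<in>?Q. filling_count (Suc m) q)"
  proof (rule sum.cong)
    fix q assume "q \<in> ?Q"
    then have "antimono q" "vstrip q p" by (auto simp: stair_shapes_def)
    then have "bij_betw (\<lambda>T. restrict (\<lambda>b. T b - 1) (boxes q))
        {T \<in> ?F. large_part p T = boxes q} (fillings_on (Suc m) (boxes q))"
      by (rule fillings_with_large_part) (rule p0)
    moreover have "{T \<in> ?F. row_lengths (large_part p T) = q} = {T \<in> ?F. large_part p T = boxes q}"
      using large_part_eq_boxes(1)[OF _ anti fin] by (auto simp: boxes_eq_iff)
    ultimately show "(\<Sum>T\<in>{T \<in> ?F. row_lengths (large_part p T) = q}. 1) = filling_count (Suc m) q"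
      by (simp add: filling_count_def bij_betw_same_card)
  qed simp
  finally show ?thesis by (simp add: filling_count_def)
qed

section \<open>Expansions into alternants\<close>

text \<open>If adding at most one box per row does not give a partition, then two consecutive
  exponents of the corresponding alternant coincide.\<close>

lemma sum_choices_eq_sum_vstrips:
  assumes q: "antimono q"
    and vanish: "\<And>p k. Suc k < n \<Longrightarrow> p (Suc k) = Suc (p k) \<Longrightarrow> F p = 0"
  shows "(\<Sum>p\<in>padded_choices n (\<lambda>j. {q j, Suc (q j)}). F p) =
    (\<Sum>p | antimono p \<and> (\<forall>k<n. q k \<le> p k \<and> p k \<le> Suc (q k)) \<and> (\<forall>k\<ge>n. p k = 0). F p)"
proof (rule sum.mono_neutral_right)
  let ?P = "padded_choices n (\<lambda>j. {q j, Suc (q j)})"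
  let ?S = "{p. antimono p \<and> (\<forall>k<n. q k \<le> p k \<and> p k \<le> Suc (q k)) \<and> (\<forall>k\<ge>n. p k = 0)}"
  show "finite ?P" by (rule finite_padded_choices) simp
  show "?S \<subseteq> ?P" by (auto simp: padded_choices_def le_Suc_eq)
  show "\<forall>p\<in>?P - ?S. F p = 0"
  proof
    fix p assume p: "p \<in> ?P - ?S"
    have "\<not> antimono p" using p by (auto simp: padded_choices_def)
    then obtain k where k: "p k < p (Suc k)" by (auto simp: antimono_iff_le_Suc not_le)
    then have "Suc k < n" using p by (cases "Suc k < n") (auto simp: padded_choices_def)
    moreover have "p (Suc k) = Suc (p k)"
    proof -
      have *: "\<forall>k<n. p k = q k \<or> p k = Suc (q k)"
        using p by (simp add: padded_choices_def)
      have "q k \<le> p k" "p (Suc k) \<le> Suc (q (Suc k))"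
        using *[rule_format, of k] *[rule_format, of "Suc k"] \<open>Suc k < n\<close> by auto
      then show ?thesis using k antimonoD[OF q, of k "Suc k"] by simp
    qed
    ultimately show "F p = 0" by (rule vanish)
  qed
qed

text \<open>Every row of a shape in the staircase of size \<open>m\<close> grows by at most one box;
  the range \<open>k < Suc m\<close> also admits row \<open>m\<close>, which is empty in
  \<open>q\<close>.\<close>

lemma vstrips_within_stair:
  assumes q: "q \<in> stair_shapes m"
  shows "{p. antimono p \<and> (\<forall>k<Suc m. q k \<le> p k \<and> p k \<le> Suc (q k)) \<and> (\<forall>k\<ge>Suc m. p k = 0)}
    = {p \<in> stair_shapes (Suc m). vstrip q p}"
proof safe
  fix p assume p: "antimono p" "\<forall>k<Suc m. q k \<le> p k \<and> p k \<le> Suc (q k)" "\<forall>k\<ge>Suc m. p k = 0"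
  have "p k \<le> Suc m - k" for k
  proof (cases "k < Suc m")
    case True
    then have "p k \<le> Suc (q k)" "q k \<le> m - k" using p q by (auto simp: stair_shapes_def)
    then show ?thesis using True by simp
  qed (use p in simp)
  then show "p \<in> stair_shapes (Suc m)" using p by (simp add: stair_shapes_def)
  have "q k \<le> p k \<and> p k \<le> Suc (q k)" for k
    using p stair_shapes_zero[OF q, of k] by (cases "k < Suc m") auto
  then show "vstrip q p" by (auto simp: vstrip_def le_fun_def)
qed (auto simp: vstrip_def le_fun_def stair_shapes_zero, auto simp: stair_shapes_def)

text \<open>A dual Pieri rule in generating-function form. The factor \<open>1 + u * x i\<close>
  multiplies matrix row \<open>i\<close>, and every column \<open>j\<close> is split accordingly:
  choosing 1 keeps the length of row \<open>j\<close> of the shape, choosing \<open>u * x i\<close>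
  adds one box of weight \<open>u\<close> to it.\<close>

lemma alternant_mult_prod:
  assumes q: "q \<in> stair_shapes m"
  shows "(\<Prod>i<Suc m. 1 + u * x i) * alternant x (Suc m) q =
    (\<Sum>p | p \<in> stair_shapes (Suc m) \<and> vstrip q p.
       u ^ (\<Sum>j<Suc m. p j - q j) * alternant x (Suc m) p)"
proof -
  let ?n = "Suc m"
  have "(\<Prod>i<?n. 1 + u * x i) * alternant x ?n q
      = fdet ?n (\<lambda>i j. \<Sum>e\<in>{q j, Suc (q j)}. u ^ (e - q j) * x i ^ (e + (?n - Suc j)))"
    unfolding alternant_def fdet_scale_rows[symmetric]
    by (rule fdet_cong) (simp add: ring_distribs mult_ac del: add_diff_assoc diff_Suc_Suc)
  also have "\<dots> = (\<Sum>p\<in>padded_choices ?n (\<lambda>j. {q j, Suc (q j)}).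
      u ^ (\<Sum>j<?n. p j - q j) * alternant x ?n p)"
    by (subst fdet_sum_cols) (simp_all add: fdet_scale_cols alternant_def power_sum
        del: sum.lessThan_Suc prod.lessThan_Suc)
  also have "\<dots> = (\<Sum>p | antimono p \<and> (\<forall>k<?n. q k \<le> p k \<and> p k \<le> Suc (q k)) \<and> (\<forall>k\<ge>?n. p k = 0).
      u ^ (\<Sum>j<?n. p j - q j) * alternant x ?n p)"
  proof (rule sum_choices_eq_sum_vstrips)
    show "antimono q" using q by (simp add: stair_shapes_def)
    fix p k assume k: "Suc k < ?n" "p (Suc k) = Suc (p k)"
    then have "alternant x ?n p = 0"
      unfolding alternant_def
      by (intro fdet_eq_cols[of k _ "Suc k"]) (auto simp: Suc_diff_Suc simp flip: power_Suc)
    then show "u ^ (\<Sum>j<?n. p j - q j) * alternant x ?n p = 0" by simp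
  qed
  finally show ?thesis
    using vstrips_within_stair[OF q] by simp
qed

text \<open>These determinants interpolate between the Vandermonde determinant in the elements
  \<open>x\<^sub>i (1 + x\<^sub>i)\<close> (for \<open>n = 0\<close>) and the alternants in the \<open>x\<^sub>i\<close> (for \<open>n = N\<close>).\<close>

definition mixed_alternant :: "(nat \<Rightarrow> 'a::comm_ring_1) \<Rightarrow> nat \<Rightarrow> nat \<Rightarrow> (nat \<Rightarrow> nat) \<Rightarrow> 'a" where
  "mixed_alternant x N n p = fdet N (\<lambda>i j.
     if j < n then x i ^ (p j + (n - Suc j)) * (x i * (1 + x i)) ^ (N - n)
     else (x i * (1 + x i)) ^ (N - Suc j))"

text \<open>One factor \<open>x i * (1 + x i)\<close> is split off in each of the first
  \<open>Suc m\<close> columns: \<open>x i\<close> raises the staircase part of the exponent, and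
  \<open>1 + x i\<close> offers the choice of one more box. The next column already has the required
  form with row length 0.\<close>

lemma mixed_alternant_Suc:
  assumes q: "q \<in> stair_shapes m" and m: "Suc m < N"
  shows "mixed_alternant x N (Suc m) q =
    (\<Sum>p | p \<in> stair_shapes (Suc m) \<and> vstrip q p. mixed_alternant x N (Suc (Suc m)) p)"
proof -
  let ?n = "Suc m"
  \<comment> \<open>Columns from \<open>?n\<close> on are not expanded; the value 0 agrees with the
    padding and gives column \<open>?n\<close> an empty row.\<close>
  define I where "I j = (if j < ?n then {q j, Suc (q j)} else {0})" for j
  have split: "N - ?n = Suc (N - Suc ?n)" using m by simp
  have "mixed_alternant x N ?n q = fdet N (\<lambda>i j. \<Sum>e\<in>I j.
      if j < Suc ?n then x i ^ (e + (Suc ?n - Suc j)) * (x i * (1 + x i)) ^ (N - Suc ?n)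
      else (x i * (1 + x i)) ^ (N - Suc j))"
    unfolding mixed_alternant_def
  proof (rule fdet_cong)
    fix i j
    consider "j < ?n" | "j = ?n" | "j > ?n" by linarith
    then show "(if j < ?n then x i ^ (q j + (?n - Suc j)) * (x i * (1 + x i)) ^ (N - ?n)
        else (x i * (1 + x i)) ^ (N - Suc j)) = (\<Sum>e\<in>I j.
      if j < Suc ?n then x i ^ (e + (Suc ?n - Suc j)) * (x i * (1 + x i)) ^ (N - Suc ?n)
      else (x i * (1 + x i)) ^ (N - Suc j))"
    proof cases
      case 1
      then have n: "Suc ?n - Suc j = Suc (?n - Suc j)" by simp
      have "x i ^ (a + d) * (x i * (1 + x i) * y) = (\<Sum>e\<in>{a, Suc a}. x i ^ (e + Suc d) * y)"
        for a d and y :: 'a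
        by (simp add: algebra_simps)
      with 1 less_SucI[OF 1] show ?thesis
        unfolding split n I_def power_Suc[of "x i * (1 + x i)"] by (simp only: if_True)
    qed (auto simp: I_def)
  qed
  also have "\<dots> = (\<Sum>p\<in>padded_choices N I. mixed_alternant x N (Suc ?n) p)"
    unfolding mixed_alternant_def by (rule fdet_sum_cols) (simp add: I_def)
  also have "padded_choices N I = padded_choices ?n (\<lambda>j. {q j, Suc (q j)})"
  proof -
    have "(\<forall>k<N. p k \<in> I k) \<and> (\<forall>k\<ge>N. p k = 0) \<longleftrightarrow>
        (\<forall>k<?n. p k \<in> {q k, Suc (q k)}) \<and> (\<forall>k\<ge>?n. p k = 0)" for p
    proof (rule iffI; elim conjE; intro conjI allI impI)
      fix k assume *: "\<forall>k<N. p k \<in> I k" "\<forall>k\<ge>N. p k = 0"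
      show "p k = 0" if "k \<ge> ?n"
        using *[rule_format, of k] that by (cases "k < N") (auto simp: I_def)
      show "p k \<in> {q k, Suc (q k)}" if "k < ?n"
        using *(1)[rule_format, of k] that m by (simp add: I_def)
    next
      fix k assume "\<forall>k<?n. p k \<in> {q k, Suc (q k)}" "\<forall>k\<ge>?n. p k = 0"
      then show "p k \<in> I k" by (cases "k < ?n") (auto simp: I_def)
    qed (use m in auto)
    then show ?thesis by (auto simp: padded_choices_def)
  qed
  also have "(\<Sum>p\<in>padded_choices ?n (\<lambda>j. {q j, Suc (q j)}). mixed_alternant x N (Suc ?n) p)
      = (\<Sum>p | antimono p \<and> (\<forall>k<?n. q k \<le> p k \<and> p k \<le> Suc (q k)) \<and> (\<forall>k\<ge>?n. p k = 0).
          mixed_alternant x N (Suc ?n) p)"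
  proof (rule sum_choices_eq_sum_vstrips)
    show "antimono q" using q by (simp add: stair_shapes_def)
    fix p k assume k: "Suc k < ?n" "p (Suc k) = Suc (p k)"
    then have "p (Suc k) + (Suc ?n - Suc (Suc k)) = p k + (Suc ?n - Suc k)" by simp
    then show "mixed_alternant x N (Suc ?n) p = 0"
      unfolding mixed_alternant_def using k m
      by (intro fdet_eq_cols[of k _ "Suc k"]) auto
  qed
  finally show ?thesis
    using vstrips_within_stair[OF q] by simp
qed

text \<open>The sum is the same for all \<open>m\<close>: counts and determinants obey recurrences
  over the same pairs \<open>vstrip q p\<close>, and interchanging the two sums leads from
  \<open>Suc m\<close> back to \<open>m\<close>.\<close>

lemma sum_filling_count_mixed_alternant:
  assumes "m < N"
  shows "(\<Sum>p\<in>stair_shapes m. of_nat (filling_count (Suc m) p) * mixed_alternant x N (Suc m) p)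
    = vandermonde (\<lambda>i. x i * (1 + x i)) N"
  using assms
proof (induction m)
  case 0
  have "stair_shapes 0 = {\<lambda>_. 0}" by (auto simp: stair_shapes_def monotone_def)
  moreover have "filling_count (Suc 0) (\<lambda>_. 0) = 1"
  proof -
    have "boxes (\<lambda>_. 0) = {}" by (auto simp: boxes_def)
    moreover have "fillings_on (Suc 0) {} = {\<lambda>_. undefined}" by (auto simp: fillings_on_def)
    ultimately show ?thesis by (simp add: filling_count_def)
  qed
  \<comment> \<open>For the empty shape, column 0 is \<open>(x i * (1 + x i)) ^ (N - 1)\<close>, so
    all columns are powers of these elements.\<close>
  moreover have "mixed_alternant x N (Suc 0) (\<lambda>_. 0) = vandermonde (\<lambda>i. x i * (1 + x i)) N"
    unfolding mixed_alternant_def fdet_vandermonde[symmetric] by (rule fdet_cong) auto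
  ultimately show ?case by simp
next
  case (Suc m)
  let ?r = "\<lambda>n p. of_nat (filling_count n p) :: 'a"
  let ?M = "mixed_alternant x N"
  have "(\<Sum>p\<in>stair_shapes (Suc m). ?r (Suc (Suc m)) p * ?M (Suc (Suc m)) p)
      = (\<Sum>p\<in>stair_shapes (Suc m). \<Sum>q | q \<in> stair_shapes m \<and> vstrip q p.
           ?r (Suc m) q * ?M (Suc (Suc m)) p)"
    by (intro sum.cong) (auto simp: filling_count_Suc sum_distrib_right)
  also have "\<dots> = (\<Sum>q\<in>stair_shapes m. \<Sum>p | p \<in> stair_shapes (Suc m) \<and> vstrip q p.
           ?r (Suc m) q * ?M (Suc (Suc m)) p)"
    by (rule sum.swap_restrict[OF finite_stair_shapes finite_stair_shapes])
  also have "\<dots> = (\<Sum>q\<in>stair_shapes m. ?r (Suc m) q * ?M (Suc m) q)"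
    using Suc.prems by (intro sum.cong) (auto simp: mixed_alternant_Suc sum_distrib_left)
  also have "\<dots> = vandermonde (\<lambda>i. x i * (1 + x i)) N"
    using Suc by simp
  finally show ?case .
qed

text \<open>At \<open>N = Suc m\<close> every column is expanded and the mixed determinants are
  alternants, while the difference of \<open>x i * (1 + x i)\<close> and
  \<open>x j * (1 + x j)\<close> is \<open>(x i - x j) * (1 + x i + x j)\<close>.\<close>

lemma sum_filling_count_alternant:
  "(\<Sum>p\<in>stair_shapes m. of_nat (filling_count (Suc m) p) * alternant x (Suc m) p)
    = vandermonde x (Suc m) * (\<Prod>j<Suc m. \<Prod>i<j. 1 + x i + x j)"
proof -
  have "mixed_alternant x (Suc m) (Suc m) p = alternant x (Suc m) p" for p
    unfolding mixed_alternant_def alternant_def by (rule fdet_cong) simp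
  moreover have "vandermonde (\<lambda>i. x i * (1 + x i)) (Suc m)
      = vandermonde x (Suc m) * (\<Prod>j<Suc m. \<Prod>i<j. 1 + x i + x j)"
    unfolding vandermonde_def prod.distrib[symmetric]
    by (intro prod.cong) (auto simp: algebra_simps)
  ultimately show ?thesis
    using sum_filling_count_mixed_alternant[of m "Suc m" x] by simp
qed

section \<open>Cancelling the Vandermonde determinant\<close>

lemma X_eq_iff: "X i = X j \<longleftrightarrow> i = j"
proof
  assume "X i = X j"
  then have "Poly_Mapping.keys (X i) = Poly_Mapping.keys (X j)" by simp
  then have "Poly_Mapping.single i (1::nat) = Poly_Mapping.single j 1" by (simp add: X_def)
  then have "Poly_Mapping.keys (Poly_Mapping.single i (1::nat)) = Poly_Mapping.keys (Poly_Mapping.single j (1::nat))"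
    by simp
  then show "i = j" by simp
qed simp

text \<open>Distinct variables have nonzero differences, and integer polynomials have no zero
  divisors.\<close>

lemma vandermonde_X_nonzero: "vandermonde (\<lambda>i. X (Suc i)) n \<noteq> 0"
  by (auto simp: vandermonde_def X_eq_iff)

lemma bialternant_stair:
  assumes "p \<in> stair_shapes m" "m \<le> n"
  shows "alternant (\<lambda>i. X (Suc i)) n p = schur_on n p * vandermonde (\<lambda>i. X (Suc i)) n"
  using assms stair_shapes_zero by (intro bialternant) (auto simp: stair_shapes_def)

lemma prod_lt_eq_sum_schur_on:
  "(\<Prod>j<Suc m. \<Prod>i<j. 1 + X (Suc i) + X (Suc j)) =
    (\<Sum>p\<in>stair_shapes m. of_nat (filling_count (Suc m) p) * schur_on (Suc m) p)"
proof -
  let ?V = "vandermonde (\<lambda>i. X (Suc i)) (Suc m)"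
  have "?V * (\<Prod>j<Suc m. \<Prod>i<j. 1 + X (Suc i) + X (Suc j)) =
      ?V * (\<Sum>p\<in>stair_shapes m. of_nat (filling_count (Suc m) p) * schur_on (Suc m) p)"
    unfolding sum_filling_count_alternant[symmetric] sum_distrib_left
    by (intro sum.cong) (auto simp: bialternant_stair mult_ac)
  then show ?thesis using vandermonde_X_nonzero by simp
qed

text \<open>The diagonal factors are applied while the expansion is still in alternants, by
  \<open>alternant_mult_prod\<close> with \<open>u = 2\<close>; then the sums are interchanged and
  the Vandermonde determinant is cancelled.\<close>

lemma prod_le_eq_sum_schur_on:
  "(\<Prod>i<Suc m. 1 + 2 * X (Suc i)) * (\<Prod>j<Suc m. \<Prod>i<j. 1 + X (Suc i) + X (Suc j)) =
    (\<Sum>p\<in>stair_shapes (Suc m). \<Sum>q | q \<in> stair_shapes m \<and> vstrip q p.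
       2 ^ (\<Sum>j<Suc m. p j - q j) * of_nat (filling_count (Suc m) q) * schur_on (Suc m) p)"
    (is "?D * ?P = ?R")
proof -
  let ?x = "\<lambda>i. X (Suc i)"
  let ?V = "vandermonde ?x (Suc m)"
  let ?r = "\<lambda>p. of_nat (filling_count (Suc m) p) :: mpoly_int"
  have "?V * (?D * ?P) = ?D * (\<Sum>q\<in>stair_shapes m. ?r q * alternant ?x (Suc m) q)"
    unfolding sum_filling_count_alternant by (simp add: mult_ac)
  also have "\<dots> = (\<Sum>q\<in>stair_shapes m. ?r q * (?D * alternant ?x (Suc m) q))"
    unfolding sum_distrib_left by (simp only: mult.left_commute)
  also have "\<dots> = (\<Sum>q\<in>stair_shapes m. \<Sum>p | p \<in> stair_shapes (Suc m) \<and> vstrip q p.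
      ?r q * (2 ^ (\<Sum>j<Suc m. p j - q j) * alternant ?x (Suc m) p))"
    by (intro sum.cong) (auto simp only: alternant_mult_prod sum_distrib_left)
  also have "\<dots> = (\<Sum>p\<in>stair_shapes (Suc m). \<Sum>q | q \<in> stair_shapes m \<and> vstrip q p.
      ?r q * (2 ^ (\<Sum>j<Suc m. p j - q j) * alternant ?x (Suc m) p))"
    by (rule sum.swap_restrict[OF finite_stair_shapes finite_stair_shapes])
  also have "\<dots> = ?V * ?R"
    unfolding sum_distrib_left
    by (intro sum.cong) (auto simp: bialternant_stair mult_ac)
  finally show ?thesis using vandermonde_X_nonzero by simp
qed

section \<open>Translation to partitions as lists\<close>

definition parts :: "nat list \<Rightarrow> nat \<Rightarrow> nat" where
  "parts \<mu> k = (if k < length \<mu> then \<mu> ! k else 0)"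

lemma ferrers_eq_boxes: "ferrers \<mu> = boxes (parts \<mu>)"
  by (auto simp: ferrers_def boxes_def parts_def split: if_splits)

lemma parts_staircase: "parts (staircase m) = (\<lambda>k. m - k)"
  by (auto simp: fun_eq_iff parts_def staircase_def rev_nth simp del: upt_Suc)

lemma antimono_parts:
  assumes "is_partition \<mu>"
  shows "antimono (parts \<mu>)"
  using assms
  by (auto simp: is_partition_def antimono_iff_le_Suc parts_def sorted_wrt_iff_nth_less)

text \<open>As all parts are positive, the length of the list is recovered from the places where
  \<open>parts\<close> is nonzero.\<close>

lemma inj_on_parts: "inj_on parts {\<mu>. is_partition \<mu>}"
proof (rule inj_onI)
  fix \<mu> \<nu> assume p: "\<mu> \<in> {\<mu>. is_partition \<mu>}" "\<nu> \<in> {\<mu>. is_partition \<mu>}" "parts \<mu> = parts \<nu>"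
  have len: "k < length \<mu> \<longleftrightarrow> parts \<mu> k \<noteq> 0" if "is_partition \<mu>" for k \<mu>
    using that by (auto simp: is_partition_def parts_def)
  have "length \<mu> = length \<nu>"
    using len[of \<mu>] len[of \<nu>] p by (metis linorder_neqE_nat mem_Collect_eq less_irrefl)
  then show "\<mu> = \<nu>"
    using p(3) by (intro nth_equalityI) (auto simp: parts_def fun_eq_iff, metis)
qed

lemma parts_surj:
  assumes p: "antimono p" and "p m = 0"
  obtains \<mu> where "is_partition \<mu>" "parts \<mu> = p"
proof
  \<comment> \<open>The list stops at the first zero; monotonicity makes \<open>p\<close> vanish
    from there on.\<close>
  define l where "l = (LEAST k. p k = 0)"
  have pl: "p l = 0" unfolding l_def using assms(2) by (rule LeastI)
  have pos: "0 < p k" if "k < l" for k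
    using not_less_Least[of k "\<lambda>k. p k = 0"] that by (simp add: l_def)
  show "is_partition (map p [0..<l])"
    using pos antimonoD[OF p] by (auto simp: is_partition_def sorted_wrt_iff_nth_less)
  show "parts (map p [0..<l]) = p"
  proof
    fix k
    show "parts (map p [0..<l]) k = p k"
      using antimonoD[OF p, of l k] pl by (cases "k < l") (auto simp: parts_def)
  qed
qed

text \<open>The predicate \<open>P\<close> covers both kinds of index sets in the final sums: shapes
  in a staircase, with or without the vertical strip condition. The assumption supplies the zero
  needed by \<open>parts_surj\<close>.\<close>

lemma bij_betw_parts:
  assumes "\<And>p. P p \<Longrightarrow> p \<in> stair_shapes m"
  shows "bij_betw parts {\<mu>. is_partition \<mu> \<and> P (parts \<mu>)} {p. P p}"
proof (rule bij_betw_imageI)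
  show "inj_on parts {\<mu>. is_partition \<mu> \<and> P (parts \<mu>)}"
    by (rule inj_on_subset[OF inj_on_parts]) auto
  have "p \<in> parts ` {\<mu>. is_partition \<mu> \<and> P (parts \<mu>)}" if "P p" for p
  proof -
    have "antimono p" "p m = 0"
      using assms[OF that] stair_shapes_zero[of p m m] by (auto simp: stair_shapes_def)
    then obtain \<mu> where "is_partition \<mu>" "parts \<mu> = p" by (rule parts_surj)
    with that show ?thesis by (intro image_eqI[of _ _ \<mu>]) auto
  qed
  then show "parts ` {\<mu>. is_partition \<mu> \<and> P (parts \<mu>)} = {p. P p}" by auto
qed

lemma schur_eq: "schur n \<mu> = schur_on n (parts \<mu>)"
  by (simp add: schur_def schur_on_def semistandard_tableaux_def tableaux_on_def ferrers_eq_boxes)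

lemma rev_flag_count_eq: "rev_flag_count n \<mu> = filling_count n (parts \<mu>)"
  by (simp add: rev_flag_count_def filling_count_def reverse_flagged_fillings_def
      fillings_on_def ferrers_eq_boxes)

lemma ferrers_subset_staircase:
  assumes "is_partition \<mu>"
  shows "ferrers \<mu> \<subseteq> ferrers (staircase m) \<longleftrightarrow> parts \<mu> \<in> stair_shapes m"
  using antimono_parts[OF assms]
  by (simp add: ferrers_eq_boxes boxes_subset_iff parts_staircase stair_shapes_def le_fun_def)

lemma vertical_strip_boxes: "vertical_strip (boxes p - boxes q) \<longleftrightarrow> (\<forall>k. p k \<le> Suc (q k))"
proof
  assume *: "vertical_strip (boxes p - boxes q)"
  show "\<forall>k. p k \<le> Suc (q k)"
  proof (rule allI, rule ccontr)
    fix k assume "\<not> p k \<le> Suc (q k)"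
    then have "(Suc k, Suc (q k)) \<in> boxes p - boxes q" "(Suc k, Suc (Suc (q k))) \<in> boxes p - boxes q"
      by (auto simp: Suc_in_boxes)
    with * show False unfolding vertical_strip_def by (metis n_not_Suc_n)
  qed
next
  assume *: "\<forall>k. p k \<le> Suc (q k)"
  show "vertical_strip (boxes p - boxes q)"
    unfolding vertical_strip_def
  proof (intro allI impI)
    fix i j j' assume "(i, j) \<in> boxes p - boxes q" "(i, j') \<in> boxes p - boxes q"
    then show "j = j'" using *[rule_format, of "i - 1"] by (auto simp: boxes_def)
  qed
qed

section \<open>Products over pairs of indices and the two expansions\<close>

lemma prod_lt_pairs:
  "(\<Prod>(i, j)\<in>{(i, j). 1 \<le> i \<and> i < j \<and> j \<le> n}. f i j) = (\<Prod>j<n. \<Prod>i<j. f (Suc i) (Suc j))"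
proof -
  have "(\<Prod>j<n. \<Prod>i<j. f (Suc i) (Suc j))
      = (\<Prod>(j, i)\<in>(SIGMA j:{..<n}. {..<j}). f (Suc i) (Suc j))"
    by (rule prod.Sigma) auto
  also have "\<dots> = (\<Prod>(i, j)\<in>{(i, j). 1 \<le> i \<and> i < j \<and> j \<le> n}. f i j)"
    by (rule prod.reindex_bij_witness[where i = "\<lambda>(i, j). (j - 1, i - 1)"
          and j = "\<lambda>(j, i). (Suc i, Suc j)"]) auto
  finally show ?thesis by simp
qed

lemma prod_le_pairs:
  "(\<Prod>(i, j)\<in>{(i, j). 1 \<le> i \<and> i \<le> j \<and> j \<le> n}. f i j)
    = (\<Prod>i<n. f (Suc i) (Suc i)) * (\<Prod>(i, j)\<in>{(i, j). 1 \<le> i \<and> i < j \<and> j \<le> n}. f i j)"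
proof -
  let ?L = "{(i, j). 1 \<le> i \<and> i < j \<and> j \<le> n}"
  let ?E = "(\<lambda>i. (Suc i, Suc i)) ` {..<n}"
  have "finite ?L" by (rule finite_subset[of _ "{..n} \<times> {..n}"]) auto
  moreover have "{(i, j). 1 \<le> i \<and> i \<le> j \<and> j \<le> n} = ?E \<union> ?L"
  proof -
    have "(i, i) \<in> ?E" if "1 \<le> i" "i \<le> n" for i
      using that by (intro image_eqI[of _ _ "i - 1"]) auto
    then show ?thesis by (auto simp: le_less)
  qed
  moreover have "?E \<inter> ?L = {}" by auto
  moreover have "(\<Prod>(i, j)\<in>?E. f i j) = (\<Prod>i<n. f (Suc i) (Suc i))"
    by (subst prod.reindex) (auto simp: inj_on_def)
  ultimately show ?thesis by (simp add: prod.union_disjoint)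
qed

theorem theorem4p2:
  fixes n :: nat
  assumes "n \<ge> 1"
  shows
    "(\<Prod>(i, j)\<in>{(i, j). 1 \<le> i \<and> i < j \<and> j \<le> n}. 1 + X i + X j) =
       (\<Sum>\<mu> | is_partition \<mu> \<and> ferrers \<mu> \<subseteq> ferrers (staircase (n - 1)).
          of_nat (rev_flag_count n \<mu>) * schur n \<mu>) \<and>
     (\<Prod>(i, j)\<in>{(i, j). 1 \<le> i \<and> i \<le> j \<and> j \<le> n}. 1 + X i + X j) =
       (\<Sum>\<nu> | is_partition \<nu> \<and> ferrers \<nu> \<subseteq> ferrers (staircase n).
          \<Sum>\<mu> | is_partition \<mu> \<and> ferrers \<mu> \<subseteq> ferrers \<nu> \<inter> ferrers (staircase (n - 1)) \<and>
                 vertical_strip (ferrers \<nu> - ferrers \<mu>).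
            2 ^ card (ferrers \<nu> - ferrers \<mu>) * of_nat (rev_flag_count n \<mu>) * schur n \<nu>)"
proof -
  obtain m where n: "n = Suc m" using assms by (cases n) auto
  have shapes: "{\<mu>. is_partition \<mu> \<and> ferrers \<mu> \<subseteq> ferrers (staircase l)}
      = {\<mu>. is_partition \<mu> \<and> parts \<mu> \<in> stair_shapes l}" for l
    using ferrers_subset_staircase by (intro Collect_cong conj_cong refl)
  have bij: "bij_betw parts {\<mu>. is_partition \<mu> \<and> parts \<mu> \<in> stair_shapes l} (stair_shapes l)" for l
    using bij_betw_parts[of "\<lambda>p. p \<in> stair_shapes l" l] by simp
  have 1: "(\<Prod>(i, j)\<in>{(i, j). 1 \<le> i \<and> i < j \<and> j \<le> n}. 1 + X i + X j) =
       (\<Sum>\<mu> | is_partition \<mu> \<and> ferrers \<mu> \<subseteq> ferrers (staircase (n - 1)).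
          of_nat (rev_flag_count n \<mu>) * schur n \<mu>)"
    unfolding shapes schur_eq rev_flag_count_eq prod_lt_pairs n
    using prod_lt_eq_sum_schur_on[of m]
      sum.reindex_bij_betw[OF bij, of "\<lambda>p. of_nat (filling_count (Suc m) p) * schur_on (Suc m) p" m]
    by simp
  \<comment> \<open>Both sums are transported along \<open>parts\<close>, so the summand is written
    as a function of row lengths.\<close>
  define G where "G p q = 2 ^ (\<Sum>j<n. p j - q j) * of_nat (filling_count n q) * schur_on n p" for p q
  have inner: "(\<Sum>\<mu> | is_partition \<mu> \<and> ferrers \<mu> \<subseteq> ferrers \<nu> \<inter> ferrers (staircase (n - 1)) \<and>
                 vertical_strip (ferrers \<nu> - ferrers \<mu>).
            2 ^ card (ferrers \<nu> - ferrers \<mu>) * of_nat (rev_flag_count n \<mu>) * schur n \<nu>)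
      = (\<Sum>q | q \<in> stair_shapes m \<and> vstrip q (parts \<nu>). G (parts \<nu>) q)"
    if \<nu>: "is_partition \<nu>" "parts \<nu> \<in> stair_shapes n" for \<nu>
  proof -
    have index: "{\<mu>. is_partition \<mu> \<and> ferrers \<mu> \<subseteq> ferrers \<nu> \<inter> ferrers (staircase (n - 1)) \<and>
                 vertical_strip (ferrers \<nu> - ferrers \<mu>)}
        = {\<mu>. is_partition \<mu> \<and> parts \<mu> \<in> stair_shapes m \<and> vstrip (parts \<mu>) (parts \<nu>)}"
    proof (rule Collect_cong, rule conj_cong[OF refl])
      fix \<mu> assume "is_partition \<mu>"
      from ferrers_subset_staircase[OF this, of m]
      show "ferrers \<mu> \<subseteq> ferrers \<nu> \<inter> ferrers (staircase (n - 1)) \<and> vertical_strip (ferrers \<nu> - ferrers \<mu>)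
        \<longleftrightarrow> parts \<mu> \<in> stair_shapes m \<and> vstrip (parts \<mu>) (parts \<nu>)"
        by (auto simp only: n le_inf_iff ferrers_eq_boxes boxes_subset_iff vertical_strip_boxes vstrip_def diff_Suc_1)
    qed
    have card: "card (ferrers \<nu> - ferrers \<mu>) = (\<Sum>j<n. parts \<nu> j - parts \<mu> j)" for \<mu>
      unfolding ferrers_eq_boxes
      by (rule card_boxes_diff) (simp add: stair_shapes_zero[OF \<nu>(2)])
    have bij': "bij_betw parts
        {\<mu>. is_partition \<mu> \<and> parts \<mu> \<in> stair_shapes m \<and> vstrip (parts \<mu>) (parts \<nu>)}
        {q. q \<in> stair_shapes m \<and> vstrip q (parts \<nu>)}"
      by (rule bij_betw_parts[where m = m]) simp
    show ?thesis
      unfolding index card schur_eq rev_flag_count_eq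
        sum.reindex_bij_betw[OF bij', of "G (parts \<nu>)", symmetric]
      by (simp only: G_def)
  qed
  \<comment> \<open>The diagonal pairs give the factors \<open>1 + 2 * X (Suc i)\<close>.\<close>
  have "(\<Prod>(i, j)\<in>{(i, j). 1 \<le> i \<and> i \<le> j \<and> j \<le> n}. 1 + X i + X j)
      = (\<Prod>i<n. 1 + 2 * X (Suc i)) * (\<Prod>j<n. \<Prod>i<j. 1 + X (Suc i) + X (Suc j))"
    unfolding prod_le_pairs prod_lt_pairs by (simp only: mult_2 add.assoc)
  also have "\<dots> = (\<Sum>p\<in>stair_shapes n. \<Sum>q | q \<in> stair_shapes m \<and> vstrip q p. G p q)"
    unfolding G_def n by (rule prod_le_eq_sum_schur_on)
  also have "\<dots> = (\<Sum>\<nu> | is_partition \<nu> \<and> parts \<nu> \<in> stair_shapes n.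
      \<Sum>q | q \<in> stair_shapes m \<and> vstrip q (parts \<nu>). G (parts \<nu>) q)"
    by (rule sum.reindex_bij_betw[OF bij, symmetric])
  also have "\<dots> = (\<Sum>\<nu> | is_partition \<nu> \<and> ferrers \<nu> \<subseteq> ferrers (staircase n).
          \<Sum>\<mu> | is_partition \<mu> \<and> ferrers \<mu> \<subseteq> ferrers \<nu> \<inter> ferrers (staircase (n - 1)) \<and>
                 vertical_strip (ferrers \<nu> - ferrers \<mu>).
            2 ^ card (ferrers \<nu> - ferrers \<mu>) * of_nat (rev_flag_count n \<mu>) * schur n \<nu>)"
    unfolding shapes by (rule sum.cong[OF refl], rule inner[symmetric]) auto
  finally show ?thesis using 1 by blast
qed

end
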